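(* Let $d\colon\mathbb{N}_0\to\mathbb{Z}$ be Stern's diatomic sequence, defined by $d(0)=0$, $d(1)=1$, $d(2n)=d(n)$ and $d(2n+1)=d(n)+d(n+1)$ for all $n\ge0$, and let $D(N)=\sum_{0\le n<N}d(n)$. Let $\kappa=\log_23$ and $\varphi=\frac{1+\sqrt5}{2}$. Then there is a $1$-periodic continuous function $\Phi_D\colon\mathbb{R}\to\mathbb{R}$, Hölder continuous with every exponent smaller than $\kappa-\log_2\varphi$, such that \[D(N)=N^\kappa\,\Phi_D(\{\log_2N\})+O(N^{\log_2\varphi})\qquad(N\to\infty).\] Furthermore, let $v'(n)=(d(n),d(n+1))^\top$, $\mathcal{V}(s)=\sum_{n\ge1}n^{-s}v'(n)$, $A_1'=\begin{pmatrix}1&1\\0&1\end{pmatrix}$ and $C=\begin{pmatrix}2&1\\1&2\end{pmatrix}$. Then $\mathcal{V}(s)$ extends meromorphically to $\Re s>\log_2\varphi$ and satisfies \[(I-2^{-s}C)\mathcal{V}(s)=v'(1)+2^{-s}A_1'\sum_{k\ge1}\frac{1}{2^k}\binom{-s}{k}\mathcal{V}(s+k)\] for all $\Re s>\log_2\varphi$; both sides of this equation are analytic for $\Re s>\log_2\varphi$, and $\mathcal{V}(s)$ has in this half-plane at most simple poles, located only at $s=\log_23+\frac{2\pi i\mu}{\log2}$, $\mu\in\mathbb{Z}$.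
   Context: $\{z\}=z-\lfloor z\rfloor$ denotes the fractional part. $\binom{-s}{k}$ is the generalized binomial coefficient $\frac{(-s)(-s-1)\cdots(-s-k+1)}{k!}$. *)

theory Defs
  imports "HOL-Complex_Analysis.Complex_Analysis" "HOL-Library.Landau_Symbols"
begin

function stern :: "nat \<Rightarrow> int" where
  "stern n = (if n = 0 then 0 else if n = 1 then 1
              else if even n then stern (n div 2)
              else stern (n div 2) + stern (n div 2 + 1))"
  by auto
termination
  by (relation less_than) (auto elim!: oddE)

declare stern.simps [simp del]

lemma stern_0 [simp]: "stern 0 = 0" and stern_1 [simp]: "stern 1 = 1"
  by (simp_all add: stern.simps)

lemma stern_even: "stern (2 * n) = stern n"
  by (cases "n = 0") (simp_all add: stern.simps[of "2 * n"])

lemma stern_odd: "stern (2 * n + 1) = stern n + stern (n + 1)"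
  by (cases "n = 0") (simp_all add: stern.simps[of "Suc (2 * n)"] stern_1[simplified])

definition stern_sum :: "nat \<Rightarrow> int" where
  "stern_sum N = (\<Sum>n<N. stern n)"

definition golden_ratio :: real where
  "golden_ratio = (1 + sqrt 5) / 2"

definition holder_continuous :: "real \<Rightarrow> (real \<Rightarrow> real) \<Rightarrow> bool" where
  "holder_continuous \<alpha> f \<longleftrightarrow> (\<exists>K. \<forall>x y. \<bar>f x - f y\<bar> \<le> K * \<bar>x - y\<bar> powr \<alpha>)"

definition stern_vec :: "nat \<Rightarrow> complex ^ 2" where
  "stern_vec n = vector [of_int (stern n), of_int (stern (n + 1))]"

definition stern_A1 :: "complex ^ 2 ^ 2" where
  "stern_A1 = vector [vector [1, 1], vector [0, 1]]"

definition stern_C :: "complex ^ 2 ^ 2" where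
  "stern_C = vector [vector [2, 1], vector [1, 2]]"

text \<open>
  A value is attached to a meromorphic function also at its poles, so the left-hand side
  of the functional equation is compared with the right-hand side pointwise only off the
  poles of \<open>V\<close>; at the poles its analytic continuation (\<^const>\<open>remove_sings\<close>) is meant.
\<close>

definition stern_lhs :: "(complex \<Rightarrow> complex ^ 2) \<Rightarrow> complex \<Rightarrow> complex ^ 2" where
  "stern_lhs V s = (mat 1 - mat (2 powr (- s)) ** stern_C) *v V s"

definition stern_rhs_term :: "(complex \<Rightarrow> complex ^ 2) \<Rightarrow> complex \<Rightarrow> nat \<Rightarrow> complex ^ 2" where
  "stern_rhs_term V s k = (1 / 2 ^ k * ((- s) gchoose k)) *s V (s + of_nat k)"

definition stern_rhs :: "(complex \<Rightarrow> complex ^ 2) \<Rightarrow> complex \<Rightarrow> complex ^ 2" where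
  "stern_rhs V s =
     stern_vec 1 + (2 powr (- s)) *s (stern_A1 *v (\<Sum>\<^sub>\<infinity>k\<in>{1..}. stern_rhs_term V s k))"

end

theory Submission
  imports Defs
begin

text \<open>
  From \<open>D (2 * n) = 3 * D n + d n\<close> it follows that \<open>g n = D n + d n / 2\<close> satisfies
  \<open>g (2 * n) = 3 * g n\<close> exactly. Hence \<open>G x = lim (\<lambda>j. g \<lfloor>2 ^ j * x\<rfloor> / 3 ^ j)\<close> exists, is
  monotone, extends \<open>g\<close> and satisfies \<open>G (2 * x) = 3 * G x\<close>, so \<open>\<Phi> t = G (2 powr t) / 3 powr t\<close>
  is 1-periodic and the error term is just \<open>- d N / 2\<close>. Since \<open>d n\<close> is at most \<open>golden_ratio ^ k\<close>
  for \<open>n \<le> 2 ^ k\<close>, the increments of \<open>G\<close> at scale \<open>2 ^ -j\<close> are \<open>O((golden_ratio / 3) ^ j)\<close>,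
  which is the Hoelder condition.

  For the Dirichlet series, split \<open>n\<close> by parity and replace \<open>(2 * n + 1) powr (-s)\<close> by
  \<open>2 powr (-s) * n powr (-s)\<close>. The correction
  \<open>\<Sum>n. ((n + 1/2) powr (-s) - n powr (-s)) * v n\<close> converges absolutely and locally uniformly for
  \<open>Re s > log 2 3 - 1\<close>, and expanding it binomially gives the sum over \<open>k\<close>. Solving the
  resulting linear system for \<open>V s\<close> continues it, with poles only where \<open>2 powr s = 3\<close>.
\<close>

subsection \<open>The summatory function\<close>

lemma stern_Suc_0 [simp]: "stern (Suc 0) = 1"
  using stern_1 by simp

lemma stern_Suc_Suc_0 [simp]: "stern (Suc (Suc 0)) = 1"
  using stern_even[of 1] by (simp add: numeral_2_eq_2)

lemma stern_nonneg: "stern n \<ge> 0"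
proof (induction n rule: less_induct)
  case (less n)
  consider "n \<le> 1" | m where "n = 2 * m" "m \<ge> 1" | m where "n = 2 * m + 1" "m \<ge> 1"
    by (cases "n \<le> 1"; cases "even n") (auto elim!: evenE oddE)
  then show ?case
  proof cases
    case 1
    then have "n = 0 \<or> n = 1" by auto
    then show ?thesis by (auto simp del: One_nat_def)
  next
    case 2
    then show ?thesis using less[of m] by (simp add: stern_even)
  next
    case 3
    then show ?thesis using less[of m] less[of "m + 1"] stern_odd[of m] by auto
  qed
qed

lemma golden_ratio_gt_1: "golden_ratio > 1"
  and golden_ratio_less_2: "golden_ratio < 2"
  and golden_ratio_square: "golden_ratio ^ 2 = golden_ratio + 1"
proof -
  have "sqrt 5 > 2" "sqrt 5 < 3"
    by (auto intro!: real_less_rsqrt real_less_lsqrt)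
  then show "golden_ratio > 1" "golden_ratio < 2"
    by (auto simp: golden_ratio_def)
  show "golden_ratio ^ 2 = golden_ratio + 1"
    by (simp add: golden_ratio_def power2_eq_square field_simps)
qed

text \<open>Up to index \<open>2 ^ k\<close> the sequence is bounded by a Fibonacci number. The
  induction goes down two levels at once and closes through
  \<open>golden_ratio ^ 2 = golden_ratio + 1\<close>.\<close>

lemma stern_le_golden_ratio_power:
  assumes "n \<le> 2 ^ k"
  shows "real_of_int (stern n) \<le> golden_ratio ^ k"
  using assms
proof (induction k arbitrary: n rule: less_induct)
  case (less k)
  note g = golden_ratio_gt_1
  show ?case
  proof (cases "even n")
    case True
    then obtain m where m: "n = 2 * m" by (elim evenE)
    show ?thesis
    proof (cases k)
      case 0
      with less.prems m have "m = 0" by simp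
      with m 0 show ?thesis by simp
    next
      case (Suc k')
      then have "real_of_int (stern m) \<le> golden_ratio ^ k'"
        using less.IH[of k' m] less.prems m by simp
      also have "\<dots> \<le> golden_ratio ^ k"
        using g Suc by (intro power_increasing) auto
      finally show ?thesis by (simp add: m stern_even)
    qed
  next
    case False
    then obtain m where m: "n = 2 * m + 1" by (elim oddE)
    consider "k = 0" | "k = 1" | k' where "k = Suc (Suc k')"
      by (metis One_nat_def not0_implies_Suc)
    then show ?thesis
    proof cases
      case 1
      with less.prems m have "n = 1" by simp
      with 1 show ?thesis by (simp del: One_nat_def)
    next
      case 2
      with less.prems m have "n = 1" by simp
      with 2 g show ?thesis by (simp del: One_nat_def)
    next
      case 3
      have m': "m + 1 \<le> 2 ^ Suc k'"
        using less.prems m 3 by simp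
      \<comment> \<open>One of \<open>m, m + 1\<close> is even, so one of the two summands has its argument halved again.\<close>
      obtain p q where pq: "stern m + stern (m + 1) = stern p + stern (2 * q)"
          "p \<le> 2 ^ Suc k'" "2 * q \<le> 2 ^ Suc k'"
      proof (cases "even m")
        case True
        then show ?thesis using that[of "m + 1" "m div 2"] m' by auto
      next
        case False
        then show ?thesis using that[of m "(m + 1) div 2"] m' by auto
      qed
      have "real_of_int (stern p) \<le> golden_ratio ^ Suc k'"
        using less.IH[of "Suc k'" p] 3 pq by simp
      moreover have "real_of_int (stern q) \<le> golden_ratio ^ k'"
        using less.IH[of k' q] 3 pq by simp
      ultimately have "real_of_int (stern n) \<le> golden_ratio ^ k' * (golden_ratio + 1)"
        unfolding m stern_odd pq(1) stern_even by (simp add: algebra_simps)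
      also have "\<dots> = golden_ratio ^ k"
        unfolding 3 golden_ratio_square[symmetric] by (simp add: power2_eq_square)
      finally show ?thesis .
    qed
  qed
qed

lemma stern_le_powr:
  assumes "n \<ge> 1"
  shows "real_of_int (stern n) \<le> golden_ratio * real n powr log 2 golden_ratio"
proof -
  note g = golden_ratio_gt_1
  define k where "k = nat \<lfloor>log 2 n\<rfloor>"
  have k: "real k = of_int \<lfloor>log 2 n\<rfloor>"
    unfolding k_def using assms by simp
  have kn: "real k \<le> log 2 n" "log 2 n < real (Suc k)"
    unfolding of_nat_Suc k by linarith+
  have "real n = 2 powr (log 2 n)" using assms by simp
  also have "\<dots> \<le> 2 powr real (Suc k)" using kn by (intro powr_mono) auto
  also have "\<dots> = real (2 ^ Suc k)" by (subst powr_realpow) auto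
  finally have "real_of_int (stern n) \<le> golden_ratio ^ Suc k"
    by (intro stern_le_golden_ratio_power) linarith
  also have "golden_ratio ^ Suc k \<le> golden_ratio * golden_ratio powr log 2 n"
    using g kn by (simp add: powr_mono flip: powr_realpow)
  \<comment> \<open>Both sides are the exponential of \<open>ln golden_ratio * ln n / ln 2\<close>.
    The extra factor \<open>golden_ratio\<close> pays for rounding \<open>n\<close> up to
    \<open>2 ^ Suc k\<close>.\<close>
  also have "golden_ratio powr log 2 n = real n powr log 2 golden_ratio"
    using g assms by (simp add: powr_def log_def)
  finally show ?thesis .
qed

section \<open>The exactly homogeneous mean and its extension to nonnegative reals\<close>

definition stern_mean :: "nat \<Rightarrow> real" where
  "stern_mean m = real_of_int (stern_sum m) + real_of_int (stern m) / 2"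

lemma stern_sum_Suc: "stern_sum (Suc n) = stern_sum n + stern n"
  by (simp add: stern_sum_def)

lemma stern_sum_double: "stern_sum (2 * n) = 3 * stern_sum n + stern n"
proof (induction n)
  case (Suc n)
  have "stern_sum (2 * Suc n) = stern_sum (2 * n) + stern (2 * n) + stern (2 * n + 1)"
    by (simp add: stern_sum_Suc)
  then show ?case unfolding Suc.IH stern_even stern_odd by (simp add: stern_sum_Suc)
qed (simp add: stern_sum_def)

text \<open>\<open>stern_mean m\<close> is the average of \<open>stern_sum m\<close> and
  \<open>stern_sum (m + 1)\<close>; the added half term absorbs the inhomogeneous term of
  \<open>stern_sum_double\<close>.\<close>

lemma stern_mean_double: "stern_mean (2 * m) = 3 * stern_mean m"
  by (simp add: stern_mean_def stern_sum_double stern_even)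

text \<open>The average of two neighbouring terms is half of a single term at an odd index, so a
  growth bound on \<open>stern\<close> bounds the increments directly.\<close>

lemma stern_mean_Suc: "stern_mean (Suc m) = stern_mean m + real_of_int (stern (2 * m + 1)) / 2"
  unfolding stern_mean_def stern_odd by (simp add: stern_sum_Suc field_simps)

lemma stern_mean_mono: "m \<le> n \<Longrightarrow> stern_mean m \<le> stern_mean n"
  by (rule lift_Suc_mono_le[of stern_mean]) (use stern_nonneg in \<open>simp_all add: stern_mean_Suc\<close>)

definition stern_mean_limit :: "real \<Rightarrow> real" where
  "stern_mean_limit x = lim (\<lambda>j. stern_mean (nat \<lfloor>2 ^ j * x\<rfloor>) / 3 ^ j)"

context
  fixes x :: real
  assumes x: "x \<ge> 0"
begin

text \<open>The dyadic intervals of length \<open>2 ^ -j\<close> that contain \<open>x\<close> are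
  nested: passing to level \<open>Suc j\<close> moves the left endpoint up and the right endpoint
  down.\<close>

private lemma floor_double:
  "2 * nat \<lfloor>2 ^ j * x\<rfloor> \<le> nat \<lfloor>2 ^ Suc j * x\<rfloor>"
  "nat \<lfloor>2 ^ Suc j * x\<rfloor> + 1 \<le> 2 * (nat \<lfloor>2 ^ j * x\<rfloor> + 1)"
proof -
  have "2 * \<lfloor>y\<rfloor> \<le> \<lfloor>2 * y\<rfloor>" "\<lfloor>2 * y\<rfloor> < 2 * (\<lfloor>y\<rfloor> + 1)" for y :: real
    using of_int_floor_le[of y] real_of_int_floor_add_one_gt[of y]
    by (simp_all add: floor_less_iff le_floor_iff del: real_of_int_floor_add_one_gt)
  from this[of "2 ^ j * x"]
  have "2 * \<lfloor>2 ^ j * x\<rfloor> \<le> \<lfloor>2 * (2 ^ j * x)\<rfloor>" "\<lfloor>2 * (2 ^ j * x)\<rfloor> + 1 \<le> 2 * (\<lfloor>2 ^ j * x\<rfloor> + 1)"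
    by simp_all
  moreover have "\<lfloor>2 ^ j * x\<rfloor> \<ge> 0" using x by simp
  ultimately show "2 * nat \<lfloor>2 ^ j * x\<rfloor> \<le> nat \<lfloor>2 ^ Suc j * x\<rfloor>"
    "nat \<lfloor>2 ^ Suc j * x\<rfloor> + 1 \<le> 2 * (nat \<lfloor>2 ^ j * x\<rfloor> + 1)"
    by (simp_all add: mult.assoc)
qed

text \<open>By exact doubling, the quotient by \<open>3 ^ j\<close> does not change when an endpoint
  is merely rewritten at the next level; monotonicity of \<open>stern_mean\<close> then follows the
  nesting. The right endpoints below are treated in the same way.\<close>

private lemma lower_incseq: "incseq (\<lambda>j. stern_mean (nat \<lfloor>2 ^ j * x\<rfloor>) / 3 ^ j)"
proof (rule incseq_SucI)
  fix j
  show "stern_mean (nat \<lfloor>2 ^ j * x\<rfloor>) / 3 ^ j \<le> stern_mean (nat \<lfloor>2 ^ Suc j * x\<rfloor>) / 3 ^ Suc j"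
    using stern_mean_mono[OF floor_double(1)[of j]] by (simp add: stern_mean_double field_simps)
qed

private lemma upper_decseq: "decseq (\<lambda>j. stern_mean (nat \<lfloor>2 ^ j * x\<rfloor> + 1) / 3 ^ j)"
proof (rule decseq_SucI)
  fix j
  have "stern_mean (nat \<lfloor>2 ^ Suc j * x\<rfloor> + 1) \<le> 3 * stern_mean (nat \<lfloor>2 ^ j * x\<rfloor> + 1)"
    using stern_mean_mono[OF floor_double(2)[of j]] unfolding stern_mean_double .
  then show "stern_mean (nat \<lfloor>2 ^ Suc j * x\<rfloor> + 1) / 3 ^ Suc j \<le> stern_mean (nat \<lfloor>2 ^ j * x\<rfloor> + 1) / 3 ^ j"
    by (simp add: field_simps)
qed

private lemma lower_le_upper:
  "stern_mean (nat \<lfloor>2 ^ i * x\<rfloor>) / 3 ^ i \<le> stern_mean (nat \<lfloor>2 ^ j * x\<rfloor> + 1) / 3 ^ j"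
proof -
  \<comment> \<open>Both sides are moved to the finer of the two levels, where they are the
    endpoints of one dyadic interval.\<close>
  have "stern_mean (nat \<lfloor>2 ^ i * x\<rfloor>) / 3 ^ i \<le> stern_mean (nat \<lfloor>2 ^ max i j * x\<rfloor>) / 3 ^ max i j"
    using lower_incseq by (rule incseqD) simp
  also have "\<dots> \<le> stern_mean (nat \<lfloor>2 ^ max i j * x\<rfloor> + 1) / 3 ^ max i j"
    by (intro divide_right_mono stern_mean_mono) auto
  also have "\<dots> \<le> stern_mean (nat \<lfloor>2 ^ j * x\<rfloor> + 1) / 3 ^ j"
    using upper_decseq by (rule decseqD) simp
  finally show ?thesis .
qed

lemma stern_mean_limit:
  "(\<lambda>j. stern_mean (nat \<lfloor>2 ^ j * x\<rfloor>) / 3 ^ j) \<longlonglongrightarrow> stern_mean_limit x"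
proof -
  have "bdd_above (range (\<lambda>j. stern_mean (nat \<lfloor>2 ^ j * x\<rfloor>) / 3 ^ j))"
    using lower_le_upper[of _ 0] by (intro bdd_aboveI2)
  then have "convergent (\<lambda>j. stern_mean (nat \<lfloor>2 ^ j * x\<rfloor>) / 3 ^ j)"
    unfolding convergent_def using LIMSEQ_incseq_SUP[OF _ lower_incseq] by blast
  then show ?thesis
    unfolding stern_mean_limit_def by (simp add: convergent_LIMSEQ_iff)
qed

lemma stern_mean_limit_ge: "stern_mean (nat \<lfloor>2 ^ j * x\<rfloor>) / 3 ^ j \<le> stern_mean_limit x"
  using incseq_le[OF lower_incseq stern_mean_limit] .

lemma stern_mean_limit_le: "stern_mean_limit x \<le> stern_mean (nat \<lfloor>2 ^ j * x\<rfloor> + 1) / 3 ^ j"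
  by (rule LIMSEQ_le_const2[OF stern_mean_limit]) (use lower_le_upper[of _ j] in simp)

text \<open>The sequence for \<open>2 * x\<close> is the one for \<open>x\<close> with its index
  shifted by one and multiplied by 3.\<close>

lemma stern_mean_limit_double: "stern_mean_limit (2 * x) = 3 * stern_mean_limit x"
proof -
  have "(\<lambda>j. 3 * (stern_mean (nat \<lfloor>2 ^ Suc j * x\<rfloor>) / 3 ^ Suc j)) \<longlonglongrightarrow> 3 * stern_mean_limit x"
    using LIMSEQ_Suc[OF stern_mean_limit] by (rule tendsto_mult_left)
  then have "(\<lambda>j. stern_mean (nat \<lfloor>2 ^ j * (2 * x)\<rfloor>) / 3 ^ j) \<longlonglongrightarrow> 3 * stern_mean_limit x"
    by (simp add: mult_ac)
  then show ?thesis
    unfolding stern_mean_limit_def by (rule limI)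
qed

end

text \<open>For an integer argument the defining sequence is constant, again by exact
  doubling.\<close>

lemma stern_mean_limit_nat: "stern_mean_limit (real m) = stern_mean m"
proof -
  have "stern_mean (2 ^ j * m) = 3 ^ j * stern_mean m" for j
    by (induction j) (simp_all add: mult.assoc stern_mean_double)
  moreover have "nat \<lfloor>2 ^ j * real m\<rfloor> = 2 ^ j * m" for j
    by (metis floor_of_nat nat_int of_nat_mult of_nat_numeral of_nat_power)
  ultimately show ?thesis
    unfolding stern_mean_limit_def by simp
qed

lemma stern_mean_limit_mono:
  assumes "0 \<le> x" "x \<le> y"
  shows "stern_mean_limit x \<le> stern_mean_limit y"
proof (rule LIMSEQ_le[OF stern_mean_limit stern_mean_limit])
  show "\<exists>N. \<forall>j\<ge>N. stern_mean (nat \<lfloor>2 ^ j * x\<rfloor>) / 3 ^ j \<le> stern_mean (nat \<lfloor>2 ^ j * y\<rfloor>) / 3 ^ j"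
    using assms by (intro exI[of _ 0] allI impI divide_right_mono stern_mean_mono nat_mono floor_mono
        mult_left_mono) auto
qed (use assms in auto)

lemma stern_mean_limit_nonneg: "x \<ge> 0 \<Longrightarrow> stern_mean_limit x \<ge> 0"
  using stern_mean_limit_mono[of 0 x] stern_mean_limit_nat[of 0]
  by (simp add: stern_mean_def stern_sum_def)

text \<open>Each dyadic level multiplies the bound on increments by \<open>golden_ratio / 3\<close>,
  which is \<open>2 powr (- stern_exponent)\<close>.\<close>

definition stern_exponent :: real where
  "stern_exponent = log 2 3 - log 2 golden_ratio"

lemma stern_exponent_pos: "stern_exponent > 0"
  and stern_exponent_le_1: "stern_exponent \<le> 1"
  and powr_stern_exponent: "2 powr stern_exponent = 3 / golden_ratio"
proof -
  note g = golden_ratio_gt_1 golden_ratio_less_2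
  have *: "stern_exponent = log 2 (3 / golden_ratio)"
    using g by (simp add: stern_exponent_def log_divide)
  show "stern_exponent > 0" unfolding * using g by (subst zero_less_log_cancel_iff) auto
  show p: "2 powr stern_exponent = 3 / golden_ratio" unfolding * using g by simp
  \<comment> \<open>This makes \<open>3 / golden_ratio\<close> at most 2, hence the exponent at most
    1.\<close>
  have "3/2 \<le> golden_ratio"
    unfolding golden_ratio_def by (simp add: real_le_rsqrt power2_eq_square)
  then have "stern_exponent \<le> log 2 2" unfolding * using g
    by (subst log_le_cancel_iff) (auto simp: field_simps)
  then show "stern_exponent \<le> 1" by simp
qed

text \<open>The level \<open>j\<close> is chosen with \<open>2 ^ -(j + 1) < y - x\<close> and
  \<open>y - x\<close> at most \<open>2 ^ -j\<close>. Then \<open>x\<close> and \<open>y\<close> lie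
  in two adjacent dyadic intervals starting at index \<open>m\<close>, and two increments of
  \<open>stern_mean\<close>, divided by \<open>3 ^ j\<close>, control the difference.\<close>

lemma stern_mean_limit_holder:
  assumes "0 \<le> x" "x < y" "y \<le> 4" "y - x \<le> 1"
  shows "stern_mean_limit y - stern_mean_limit x
           \<le> 3 * golden_ratio ^ 3 * (y - x) powr stern_exponent"
proof -
  note g = golden_ratio_gt_1
  define j where "j = nat \<lfloor>- log 2 (y - x)\<rfloor>"
  have "log 2 (y - x) \<le> 0" using assms by (subst log_le_zero_cancel_iff) auto
  then have j: "real j \<le> - log 2 (y - x)" "- log 2 (y - x) < real j + 1"
    unfolding j_def by (simp_all add: floor_correct)
  have "2 ^ j * (y - x) = 2 powr (real j + log 2 (y - x))"
    using assms by (simp add: powr_add powr_realpow)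
  also have "\<dots> \<le> 2 powr 0" using j by (intro powr_mono) auto
  finally have step: "2 ^ j * (y - x) \<le> 1" by simp
  define m where "m = nat \<lfloor>2 ^ j * x\<rfloor>"
  have m: "real m \<le> 2 ^ j * x" "2 ^ j * x < real m + 1"
    unfolding m_def using assms by auto
  have ym: "nat \<lfloor>2 ^ j * y\<rfloor> + 1 \<le> m + 2"
  proof -
    have "2 ^ j * y < real m + 2" using step m by (simp add: algebra_simps)
    then have "\<lfloor>2 ^ j * y\<rfloor> < int m + 2" by linarith
    then show ?thesis by linarith
  qed
  \<comment> \<open>The upper bound 4 keeps the odd indices \<open>2 * m + 1\<close> and
    \<open>2 * m + 3\<close> at most \<open>11 * 2 ^ j\<close>, which explains the exponent
    \<open>j + 4\<close>.\<close>
  have "2 ^ j * x \<le> 2 ^ j * 4" using assms by (intro mult_left_mono) auto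
  with m(1) have "real m \<le> 2 ^ j * 4" by linarith
  then have "m \<le> 2 ^ j * 4" by (metis of_nat_le_iff of_nat_mult of_nat_numeral of_nat_power)
  moreover have "(1::nat) \<le> 2 ^ j" by simp
  ultimately have "2 * m + 3 \<le> 2 ^ j * 16" by linarith
  then have m16: "2 * m + 3 \<le> 2 ^ (j + 4)" by (simp add: power_add)
  have "stern_mean (m + 2) - stern_mean m = (stern (2 * m + 1) + stern (2 * (m + 1) + 1)) / 2"
    using stern_mean_Suc[of m] stern_mean_Suc[of "m + 1"] by simp
  also have "\<dots> \<le> (golden_ratio ^ (j + 4) + golden_ratio ^ (j + 4)) / 2"
    using stern_le_golden_ratio_power[of "2 * m + 1" "j + 4"]
      stern_le_golden_ratio_power[of "2 * (m + 1) + 1" "j + 4"] m16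
    by simp
  finally have diff: "stern_mean (m + 2) - stern_mean m \<le> golden_ratio ^ (j + 4)" by simp
  have "stern_mean_limit y - stern_mean_limit x
          \<le> stern_mean (nat \<lfloor>2 ^ j * y\<rfloor> + 1) / 3 ^ j - stern_mean m / 3 ^ j"
    unfolding m_def using assms
    by (intro diff_mono stern_mean_limit_le stern_mean_limit_ge) auto
  also have "\<dots> \<le> (stern_mean (m + 2) - stern_mean m) / 3 ^ j"
    using stern_mean_mono[OF ym] by (simp add: divide_simps)
  also have "\<dots> \<le> golden_ratio ^ (j + 4) / 3 ^ j"
    using diff by (intro divide_right_mono) auto
  also have "\<dots> = golden_ratio ^ 4 * (golden_ratio / 3) ^ j"
    by (simp add: power_add power_divide)
  also have "(golden_ratio / 3) ^ j = (2 powr (- stern_exponent)) ^ j"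
    by (simp add: powr_minus powr_stern_exponent)
  also have "\<dots> = 2 powr (- stern_exponent * real j)"
    by (simp add: powr_powr flip: powr_realpow)
  \<comment> \<open>Rounding in \<open>j\<close> loses less than one unit, at the price of the
    factor \<open>2 powr stern_exponent = 3 / golden_ratio\<close>; this turns
    \<open>golden_ratio ^ 4\<close> into \<open>3 * golden_ratio ^ 3\<close>.\<close>
  also have "\<dots> \<le> 2 powr (stern_exponent * (1 + log 2 (y - x)))"
  proof (rule powr_mono)
    have "stern_exponent * (- real j) \<le> stern_exponent * (1 + log 2 (y - x))"
      using stern_exponent_pos j by (intro mult_left_mono) auto
    then show "- stern_exponent * real j \<le> stern_exponent * (1 + log 2 (y - x))" by simp
  qed simp
  also have "\<dots> = 3 / golden_ratio * (y - x) powr stern_exponent"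
  proof -
    have "2 powr (stern_exponent * (1 + log 2 (y - x)))
        = 2 powr stern_exponent * (2 powr log 2 (y - x)) powr stern_exponent"
      by (simp add: powr_add powr_powr distrib_left mult.commute)
    then show ?thesis using assms by (simp add: powr_stern_exponent)
  qed
  finally show ?thesis
    using g by (simp add: eval_nat_numeral mult_ac)
qed

section \<open>The periodic function and the asymptotic formula\<close>

definition stern_periodic :: "real \<Rightarrow> real" where
  "stern_periodic t = stern_mean_limit (2 powr t) * 3 powr (- t)"

lemma stern_periodic_plus_1: "stern_periodic (t + 1) = stern_periodic t"
proof -
  have "stern_mean_limit (2 powr (t + 1)) = 3 * stern_mean_limit (2 powr t)"
    using stern_mean_limit_double[of "2 powr t"] by (simp add: powr_add mult.commute)
  moreover have "3 powr (- (t + 1)) = 3 powr (- t) / (3::real)"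
    using powr_diff[of 3 "-t" "1::real"] by simp
  ultimately show ?thesis by (simp add: stern_periodic_def)
qed

interpretation stern_periodic: periodic_fun_simple' stern_periodic
  by unfold_locales (rule stern_periodic_plus_1)

text \<open>On \<open>[0, 2]\<close> the maps \<open>2 powr t\<close> and \<open>3 powr (-t)\<close>
  are Lipschitz with constants 4 and 2, so the product inherits the bound of
  \<open>stern_mean_limit_holder\<close>. The distance 1/4 keeps the difference of the arguments at
  most 1, as that lemma demands.\<close>

lemma stern_periodic_local_holder:
  assumes "0 \<le> x" "x < y" "y \<le> 2" "y - x \<le> 1/4"
  shows "\<bar>stern_periodic y - stern_periodic x\<bar>
           \<le> (12 * golden_ratio ^ 3 + 2 * stern_mean_limit 4) * (y - x) powr stern_exponent"
proof -
  note g = golden_ratio_gt_1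
  let ?a = "2 powr x" and ?b = "2 powr y :: real"
  have ln2: "0 < ln (2::real)" "ln (2::real) < 1" using ln_2_less_1 by auto
  have ln3: "ln (3::real) \<le> 2" using ln_le_minus_one[of "3::real"] by simp
  have y4: "?b \<le> 4" using assms powr_mono[of y 2 "2::real"] by simp
  have ab: "?a < ?b" using assms by simp
  have "((\<lambda>t. 2 powr t) has_real_derivative 2 powr t * ln 2) (at t)" for t :: real
    by (auto intro!: derivative_eq_intros)
  then obtain z where z: "x < z" "z < y" "?b - ?a = (y - x) * (2 powr z * ln 2)"
    using MVT2[OF \<open>x < y\<close>, of "\<lambda>t. 2 powr t" "\<lambda>t. 2 powr t * ln 2"] by blast
  have "2 powr z \<le> (4::real)"
    using order.trans[OF powr_mono[of z y "2::real"] y4] z by simp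
  then have "2 powr z * ln 2 \<le> 4 * (1::real)"
    using ln2 by (intro mult_mono) auto
  then have ba: "?b - ?a \<le> 4 * (y - x)"
    unfolding z(3) using assms mult_left_mono[of "2 powr z * ln 2" 4 "y - x"] by (simp add: mult.commute)
  have "((\<lambda>t. 3 powr (-t)) has_real_derivative - (3 powr (-t) * ln 3)) (at t)" for t :: real
    by (auto intro!: derivative_eq_intros)
  then obtain u where u: "x < u" "u < y" "3 powr (-y) - 3 powr (-x) = (y - x) * - (3 powr (-u) * ln (3::real))"
    using MVT2[OF \<open>x < y\<close>, of "\<lambda>t. 3 powr (-t)" "\<lambda>t. - (3 powr (-t) * ln 3)"] by blast
  have "3 powr (-u) * ln (3::real) \<le> 1 * 2"
    using u assms ln3 powr_mono[of "-u" 0 "3::real"] by (intro mult_mono) auto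
  then have c: "\<bar>3 powr (-y) - 3 powr (-x)\<bar> \<le> 2 * (y - x)"
    unfolding u(3) using assms mult_left_mono[of "3 powr (-u) * ln 3" 2 "y - x"]
    by (simp add: abs_mult mult.commute)
  \<comment> \<open>Since the exponent and the distance are at most 1, the Lipschitz term is
    absorbed into the Hoelder term.\<close>
  have "(y - x) powr 1 \<le> (y - x) powr stern_exponent"
    using assms stern_exponent_le_1 by (intro powr_mono') auto
  then have lin: "y - x \<le> (y - x) powr stern_exponent" using assms by simp
  have "stern_mean_limit ?b - stern_mean_limit ?a
          \<le> 3 * golden_ratio ^ 3 * (?b - ?a) powr stern_exponent"
    using assms ab ba y4 by (intro stern_mean_limit_holder) auto
  also have "(?b - ?a) powr stern_exponent \<le> (4 * (y - x)) powr stern_exponent"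
    using ab ba stern_exponent_pos by (intro powr_mono2) auto
  also have "\<dots> = 4 powr stern_exponent * (y - x) powr stern_exponent"
    by (rule powr_mult)
  also have "\<dots> \<le> 4 * (y - x) powr stern_exponent"
    using stern_exponent_le_1 powr_mono[of stern_exponent 1 "4::real"]
    by (intro mult_right_mono) auto
  finally have "stern_mean_limit ?b - stern_mean_limit ?a
      \<le> 12 * golden_ratio ^ 3 * (y - x) powr stern_exponent" 
    using g by (simp add: mult_ac)
  moreover have "stern_mean_limit ?a \<le> stern_mean_limit ?b"
    using ab by (intro stern_mean_limit_mono) auto
  ultimately have d1: "\<bar>stern_mean_limit ?b - stern_mean_limit ?a\<bar>
      \<le> 12 * golden_ratio ^ 3 * (y - x) powr stern_exponent" by simp
  have "stern_periodic y - stern_periodic x =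
      (stern_mean_limit ?b - stern_mean_limit ?a) * 3 powr (-x)
      + stern_mean_limit ?b * (3 powr (-y) - 3 powr (-x))"
    by (simp add: stern_periodic_def algebra_simps)
  also have "\<bar>\<dots>\<bar> \<le> \<bar>stern_mean_limit ?b - stern_mean_limit ?a\<bar> * 3 powr (-x)
      + \<bar>stern_mean_limit ?b\<bar> * \<bar>3 powr (-y) - 3 powr (-x)\<bar>"
    by (rule order.trans[OF abs_triangle_ineq]) (simp add: abs_mult)
  also have "\<dots> \<le> (12 * golden_ratio ^ 3 * (y - x) powr stern_exponent) * 1
      + stern_mean_limit 4 * (2 * (y - x))"
  proof (intro add_mono mult_mono)
    show "3 powr (-x) \<le> (1::real)" using assms powr_mono[of "-x" 0 "3::real"] by simp
    show "\<bar>stern_mean_limit ?b\<bar> \<le> stern_mean_limit 4"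
      using stern_mean_limit_nonneg[of ?b] stern_mean_limit_mono[of ?b 4] y4 by simp
  qed (use d1 c g stern_mean_limit_nonneg[of 4] in auto)
  also have "\<dots> \<le> (12 * golden_ratio ^ 3 * (y - x) powr stern_exponent) * 1
      + stern_mean_limit 4 * (2 * (y - x) powr stern_exponent)"
    using lin stern_mean_limit_nonneg[of 4] by (intro add_left_mono mult_left_mono) auto
  finally show ?thesis by (simp add: algebra_simps)
qed

lemma stern_periodic_frac: "stern_periodic (frac t) = stern_periodic t"
  unfolding frac_def using stern_periodic.minus_of_int[of t "\<lfloor>t\<rfloor>"] by simp

lemma stern_periodic_bounds: "0 \<le> stern_periodic t" "stern_periodic t \<le> stern_mean_limit 2"
proof -
  show "0 \<le> stern_periodic t"
    by (simp add: stern_periodic_def stern_mean_limit_nonneg)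
  have f: "0 \<le> frac t" "frac t \<le> 1" using frac_lt_1[of t] by auto
  have "stern_periodic (frac t) \<le> stern_mean_limit 2 * 1"
    unfolding stern_periodic_def
    using f powr_mono[of "frac t" 1 "2::real"] powr_mono[of "-frac t" 0 "3::real"]
    by (intro mult_mono stern_mean_limit_mono stern_mean_limit_nonneg) auto
  then show "stern_periodic t \<le> stern_mean_limit 2" by (simp add: stern_periodic_frac)
qed

lemma stern_periodic_holder:
  assumes "0 < \<alpha>" "\<alpha> \<le> stern_exponent"
  shows "holder_continuous \<alpha> stern_periodic"
proof -
  define K where "K = 12 * golden_ratio ^ 3 + 2 * stern_mean_limit 4"
  \<comment> \<open>The second entry serves distances above 1/4: there
    \<open>(y - x) powr \<alpha>\<close> is at least 1/4, while two values of the function differ by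
    at most \<open>stern_mean_limit 2\<close>.\<close>
  define L where "L = max K (4 * stern_mean_limit 2)"
  have K: "K \<ge> 0" unfolding K_def using golden_ratio_gt_1 stern_mean_limit_nonneg[of 4] by simp
  have *: "\<bar>stern_periodic x - stern_periodic y\<bar> \<le> L * (y - x) powr \<alpha>" if "x < y" for x y
  proof (cases "y - x \<le> 1/4")
    case True
    \<comment> \<open>Translation by \<open>m\<close> puts \<open>x\<close> into
      \<open>[0, 1)\<close> and \<open>y\<close> below 2, where the local estimate applies.\<close>
    define m where "m = \<lfloor>x\<rfloor>"
    have xm: "0 \<le> x - m" "x - m < 1" unfolding m_def by linarith+
    have "\<bar>stern_periodic (y - m) - stern_periodic (x - m)\<bar> \<le> K * (y - m - (x - m)) powr stern_exponent"
      unfolding K_def using xm True that by (intro stern_periodic_local_holder) auto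
    then have "\<bar>stern_periodic x - stern_periodic y\<bar> \<le> K * (y - x) powr stern_exponent"
      by (simp add: stern_periodic.minus_of_int abs_minus_commute)
    also have "\<dots> \<le> L * (y - x) powr \<alpha>"
      using that True assms K by (intro mult_mono powr_mono') (auto simp: L_def)
    finally show ?thesis .
  next
    case False
    have "(1/4) powr 1 \<le> (1/4) powr \<alpha>"
      using assms stern_exponent_le_1 by (intro powr_mono') auto
    also have "\<dots> \<le> (y - x) powr \<alpha>"
      using False assms by (intro powr_mono2) auto
    finally have "1/4 \<le> (y - x) powr \<alpha>" by simp
    then have "4 * stern_mean_limit 2 * (1/4) \<le> L * (y - x) powr \<alpha>"
      using stern_mean_limit_nonneg[of 2] by (intro mult_mono) (auto simp: L_def)
    then show ?thesis
      using stern_periodic_bounds[of x] stern_periodic_bounds[of y] by linarith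
  qed
  have "\<bar>stern_periodic x - stern_periodic y\<bar> \<le> L * \<bar>x - y\<bar> powr \<alpha>" for x y
    using *[of x y] *[of y x] by (cases x y rule: linorder_cases) (auto simp: abs_minus_commute)
  then show ?thesis unfolding holder_continuous_def by blast
qed

lemma holder_continuous_imp_continuous_on:
  assumes "holder_continuous \<alpha> f" "\<alpha> > 0"
  shows "continuous_on UNIV f"
proof -
  obtain K where K: "\<And>x y. \<bar>f x - f y\<bar> \<le> K * \<bar>x - y\<bar> powr \<alpha>"
    using assms(1) unfolding holder_continuous_def by blast
  have "(f \<longlongrightarrow> f x) (at x)" for x
  proof -
    have "((\<lambda>y. K * \<bar>y - x\<bar> powr \<alpha>) \<longlongrightarrow> K * \<bar>x - x\<bar> powr \<alpha>) (at x)"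
      using assms(2) by (intro tendsto_intros tendsto_powr2) auto
    then have "((\<lambda>y. f y - f x) \<longlongrightarrow> 0) (at x)"
      using K by (intro Lim_null_comparison[of "\<lambda>y. f y - f x"]) (auto intro: always_eventually)
    then show ?thesis by (simp add: LIM_zero_iff)
  qed
  then show ?thesis by (simp add: continuous_on_eq_continuous_at isCont_def)
qed

lemma stern_sum_asymptotics:
  "(\<lambda>N :: nat. real_of_int (stern_sum N)
       - real N powr (log 2 3) * stern_periodic (frac (log 2 (real N))))
     \<in> O(\<lambda>N. real N powr (log 2 golden_ratio))"
proof (rule bigoI[where c = golden_ratio])
  show "eventually (\<lambda>N. norm (real_of_int (stern_sum N)
       - real N powr (log 2 3) * stern_periodic (frac (log 2 (real N))))
     \<le> golden_ratio * norm (real N powr (log 2 golden_ratio))) sequentially"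
    using eventually_ge_at_top[of 1]
  proof eventually_elim
    case (elim N)
    have "real N powr (log 2 3) = 3 powr log 2 N"
      using elim by (simp add: powr_def log_def)
    then have "real N powr (log 2 3) * stern_periodic (frac (log 2 (real N))) = stern_mean N"
      unfolding stern_periodic_frac using elim by (simp add: stern_periodic_def powr_minus stern_mean_limit_nat)
    then show ?case
      using stern_le_powr[OF elim] stern_nonneg[of N] by (simp add: stern_mean_def)
  qed
qed

subsection \<open>Dirichlet series and half-integer shifts\<close>

lemma has_sum_vecI:
  fixes f :: "'a \<Rightarrow> ('b :: {comm_monoid_add, topological_space}) ^ 'n"
  assumes "\<And>i. ((\<lambda>x. f x $ i) has_sum S $ i) A"
  shows "(f has_sum S) A"
  using assms unfolding has_sum_def by (intro vec_tendstoI) simp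

lemma has_sum_atLeast_1_iff: "(f has_sum S) {1::nat..} \<longleftrightarrow> ((\<lambda>n. f (Suc n)) has_sum S) UNIV"
  by (rule has_sum_reindex_bij_witness[of _ Suc "\<lambda>n. n - 1"]) auto

text \<open>The index 1 stands alone because it is \<open>2 * 0 + 1\<close> and both partial sums
  start at \<open>n = 1\<close>.\<close>

lemma has_sum_even_odd:
  fixes f :: "nat \<Rightarrow> 'a :: topological_comm_monoid_add"
  assumes "((\<lambda>n. f (2 * n)) has_sum A) {1..}" "((\<lambda>n. f (2 * n + 1)) has_sum B) {1..}"
  shows "(f has_sum (f 1 + A + B)) {1..}"
proof -
  have even: "(f has_sum A) ((\<lambda>n. 2 * n) ` {1..})"
    using assms(1) by (subst has_sum_reindex) (auto simp: inj_on_def o_def)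
  have odd: "(f has_sum B) ((\<lambda>n. 2 * n + 1) ` {1..})"
    using assms(2) by (subst has_sum_reindex) (auto simp: inj_on_def o_def)
  have one: "(f has_sum f 1) {1}"
    using has_sum_finite[of "{1}" f] by simp
  have "(f has_sum (f 1 + A)) ({1} \<union> (\<lambda>n. 2 * n) ` {1..})"
    by (rule has_sum_Un_disjoint[OF one even]) (auto dest: arg_cong[of _ _ even])
  from this and odd
  have "(f has_sum (f 1 + A + B)) ({1} \<union> (\<lambda>n. 2 * n) ` {1..} \<union> (\<lambda>n. 2 * n + 1) ` {1..})"
    by (rule has_sum_Un_disjoint) (auto dest: arg_cong[of _ _ even])
  also have "{1} \<union> (\<lambda>n. 2 * n) ` {1..} \<union> (\<lambda>n. 2 * n + 1) ` {1..} = {1::nat..}"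
  proof (intro equalityI subsetI)
    fix n :: nat assume n: "n \<in> {1..}"
    show "n \<in> {1} \<union> (\<lambda>n. 2 * n) ` {1..} \<union> (\<lambda>n. 2 * n + 1) ` {1..}"
    proof (cases "even n")
      case True
      then show ?thesis using n by (auto elim!: evenE)
    next
      case False
      then obtain m where "n = 2 * m + 1" by (elim oddE)
      then show ?thesis by (cases "m = 0") auto
    qed
  qed auto
  finally show ?thesis .
qed

definition dirichlet :: "(nat \<Rightarrow> complex) \<Rightarrow> complex \<Rightarrow> complex" where
  "dirichlet f s = (\<Sum>\<^sub>\<infinity>n\<in>{1..}. of_nat n powr (-s) * f n)"

text \<open>The difference is taken term by term, before summation; this gains one power of
  \<open>n\<close> and lets the series converge one unit further to the left.\<close>

definition dirichlet_half_shift :: "(nat \<Rightarrow> complex) \<Rightarrow> complex \<Rightarrow> complex" where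
  "dirichlet_half_shift f s =
     (\<Sum>\<^sub>\<infinity>n\<in>{1..}. ((of_nat n + 1/2) powr (-s) - of_nat n powr (-s)) * f n)"

text \<open>The abscissa of absolute convergence is at most \<open>c\<close>. Real exponents
  suffice, since the norm of \<open>n powr (-s)\<close> depends only on \<open>Re s\<close>.\<close>

definition abs_converges_above :: "real \<Rightarrow> (nat \<Rightarrow> complex) \<Rightarrow> bool" where
  "abs_converges_above c f \<longleftrightarrow>
     (\<forall>\<sigma>>c. (\<lambda>n. real n powr (-\<sigma>) * norm (f n)) summable_on {1..})"

lemma abs_converges_aboveD:
  "abs_converges_above c f \<Longrightarrow> \<sigma> > c \<Longrightarrow> (\<lambda>n. real n powr (-\<sigma>) * norm (f n)) summable_on {1..}"
  unfolding abs_converges_above_def by blast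

lemma abs_converges_above_add:
  assumes "abs_converges_above c f" "abs_converges_above c g"
  shows "abs_converges_above c (\<lambda>n. f n + g n)"
  unfolding abs_converges_above_def
proof (intro allI impI)
  fix \<sigma> assume "\<sigma> > c"
  then have "(\<lambda>n. real n powr (-\<sigma>) * norm (f n) + real n powr (-\<sigma>) * norm (g n)) summable_on {1..}"
    using assms unfolding abs_converges_above_def by (intro summable_on_add) auto
  then show "(\<lambda>n. real n powr (-\<sigma>) * norm (f n + g n)) summable_on {1..}"
    by (rule summable_on_comparison_test)
       (auto simp flip: distrib_left intro!: mult_left_mono norm_triangle_ineq)
qed

lemma dirichlet_has_sum:
  assumes "abs_converges_above c f" "Re s > c"
  shows "((\<lambda>n. of_nat n powr (-s) * f n) has_sum dirichlet f s) {1..}"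
proof -
  have "(\<lambda>n. norm (of_nat n powr (-s) * f n)) summable_on {1..}"
    using assms by (simp add: abs_converges_above_def norm_mult norm_powr_real_powr)
  then show ?thesis
    unfolding dirichlet_def by (rule has_sum_infsum[OF abs_summable_summable])
qed

lemma dirichlet_add:
  assumes "abs_converges_above c f" "abs_converges_above c g" "Re s > c"
  shows "dirichlet (\<lambda>n. f n + g n) s = dirichlet f s + dirichlet g s"
proof (rule has_sum_unique)
  show "((\<lambda>n. of_nat n powr (-s) * (f n + g n)) has_sum dirichlet (\<lambda>n. f n + g n) s) {1..}"
    using assms by (intro dirichlet_has_sum abs_converges_above_add)
  show "((\<lambda>n. of_nat n powr (-s) * (f n + g n)) has_sum dirichlet f s + dirichlet g s) {1..}"
    unfolding distrib_left using assms by (intro has_sum_add dirichlet_has_sum)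
qed

text \<open>Mean value inequality on the segment from \<open>x\<close> to \<open>x + 1/2\<close>:
  the derivative \<open>-s * z powr (-s-1)\<close> is largest in norm at the left end because
  \<open>Re s + 1\<close> is nonnegative.\<close>

lemma norm_powr_half_shift_le:
  assumes "x > 0" "Re s \<ge> -1"
  shows "norm ((of_real x + 1/2) powr (-s) - of_real x powr (-s))
           \<le> norm s / 2 * x powr (- (Re s + 1))"
proof -
  let ?S = "closed_segment (complex_of_real x) (complex_of_real (x + 1/2))"
  have "norm (complex_of_real (x + 1/2) powr (-s) - of_real x powr (-s))
          \<le> (norm s * x powr (- (Re s + 1))) * norm (complex_of_real (x + 1/2) - of_real x)"
  proof (rule field_differentiable_bound[where S = ?S and f' = "\<lambda>z. -s * z powr (-s-1)"])
    fix z assume "z \<in> ?S"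
    then obtain t where t: "z = of_real t" "x \<le> t"
      unfolding closed_segment_of_real by (auto simp: closed_segment_eq_real_ivl)
    have "z \<notin> \<real>\<^sub>\<le>\<^sub>0" using t assms by auto
    then show "((\<lambda>z. z powr (-s)) has_field_derivative -s * z powr (-s-1)) (at z within ?S)"
      using has_field_derivative_powr[of z "-s"] by (auto intro: has_field_derivative_at_within)
    have "norm (z powr (-s-1)) = t powr (- (Re s + 1))"
      using t assms by (simp add: norm_powr_real_powr)
    also have "\<dots> \<le> x powr (- (Re s + 1))"
      using t assms by (intro powr_mono2') auto
    finally show "norm (-s * z powr (-s-1)) \<le> norm s * x powr (- (Re s + 1))"
      by (simp add: norm_mult mult_left_mono)
  qed auto
  also have "norm (complex_of_real (x + 1/2) - of_real x) = 1/2"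
    by (simp add: norm_divide)
  finally show ?thesis by simp
qed

text \<open>The bound is uniform in \<open>s\<close> on bounded parts of a half-plane, as the
  Weierstrass test needs.\<close>

lemma norm_half_shift_term_le:
  assumes "n \<ge> 1" "\<sigma> \<ge> -1" "Re s \<ge> \<sigma>" "norm s \<le> M"
  shows "norm (((of_nat n + 1/2) powr (-s) - of_nat n powr (-s)) * z)
           \<le> M / 2 * (real n powr (- (\<sigma> + 1)) * norm z)"
proof -
  have "norm ((of_nat n + 1/2) powr (-s) - of_nat n powr (-s))
          \<le> norm s / 2 * real n powr (- (Re s + 1))"
    using norm_powr_half_shift_le[of "real n" s] assms by simp
  also have "\<dots> \<le> M / 2 * real n powr (- (\<sigma> + 1))"
    using assms order.trans[OF norm_ge_zero assms(4)] by (intro mult_mono powr_mono) auto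
  finally show ?thesis
    unfolding norm_mult mult.assoc[symmetric] by (intro mult_right_mono) auto
qed

lemma dirichlet_half_shift_has_sum:
  assumes "abs_converges_above c f" "c \<ge> 0" "Re s > c - 1"
  shows "((\<lambda>n. ((of_nat n + 1/2) powr (-s) - of_nat n powr (-s)) * f n)
           has_sum dirichlet_half_shift f s) {1..}"
proof -
  have "(\<lambda>n. norm s / 2 * (real n powr (- (Re s + 1)) * norm (f n))) summable_on {1..}"
    using assms by (intro summable_on_cmult_right abs_converges_aboveD) auto
  then have "(\<lambda>n. norm (((of_nat n + 1/2) powr (-s) - of_nat n powr (-s)) * f n)) summable_on {1..}"
    by (rule Infinite_Sum.abs_summable_on_comparison_test') (use assms in \<open>intro norm_half_shift_term_le; auto\<close>)
  then show ?thesis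
    unfolding dirichlet_half_shift_def by (rule has_sum_infsum[OF abs_summable_summable])
qed

lemma dirichlet_half_shift_add:
  assumes "abs_converges_above c f" "abs_converges_above c g" "c \<ge> 0" "Re s > c - 1"
  shows "dirichlet_half_shift (\<lambda>n. f n + g n) s = dirichlet_half_shift f s + dirichlet_half_shift g s"
proof (rule has_sum_unique)
  show "((\<lambda>n. ((of_nat n + 1/2) powr (-s) - of_nat n powr (-s)) * (f n + g n))
      has_sum dirichlet_half_shift (\<lambda>n. f n + g n) s) {1..}"
    using assms by (intro dirichlet_half_shift_has_sum abs_converges_above_add)
  show "((\<lambda>n. ((of_nat n + 1/2) powr (-s) - of_nat n powr (-s)) * (f n + g n))
      has_sum dirichlet_half_shift f s + dirichlet_half_shift g s) {1..}"
    unfolding distrib_left using assms by (intro has_sum_add dirichlet_half_shift_has_sum)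
qed

lemma dirichlet_half_shift_holomorphic:
  assumes "abs_converges_above c f" "c \<ge> 0"
  shows "dirichlet_half_shift f holomorphic_on {s. Re s > c - 1}"
proof -
  let ?S = "{s. Re s > c - 1}"
  define t where "t n s = ((of_nat (Suc n) + 1/2) powr (-s) - of_nat (Suc n) powr (-s)) * f (Suc n)"
    for n s
  have op: "open ?S" by (rule open_halfspace_Re_gt)
  have t_hol: "t n holomorphic_on UNIV" for n
    unfolding t_def by (intro holomorphic_intros) 
  have "\<exists>g g'. \<forall>x\<in>?S. (\<lambda>n. t n x) sums g x \<and> (\<lambda>n. deriv (t n) x) sums g' x
          \<and> (g has_field_derivative g' x) (at x)"
  proof (rule series_and_derivative_comparison_complex[OF op])
    show "(t n has_field_derivative deriv (t n) x) (at x)" for n x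
      using holomorphic_derivI[OF t_hol open_UNIV] by auto
  next
    fix s assume s: "s \<in> ?S"
    \<comment> \<open>Half the distance to the boundary line: the ball of radius \<open>d\<close>
      around \<open>s\<close> stays in the half-plane \<open>Re y > \<sigma>\<close>, with
      \<open>\<sigma>\<close> still above \<open>c - 1\<close>.\<close>
    define d where "d = (Re s - (c - 1)) / 2"
    define \<sigma> where "\<sigma> = Re s - d"
    define h where "h n = (norm s + d) / 2 * (real (Suc n) powr (- (\<sigma> + 1)) * norm (f (Suc n)))" for n
    have d: "d > 0" and \<sigma>: "\<sigma> > c - 1"
      using s by (auto simp: d_def \<sigma>_def field_simps)
    have "(\<lambda>n. real n powr (- (\<sigma> + 1)) * norm (f n)) summable_on {1..}"
      using assms(1) \<sigma> by (intro abs_converges_aboveD) auto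
    then have "(\<lambda>n. real (Suc n) powr (- (\<sigma> + 1)) * norm (f (Suc n))) summable_on UNIV"
      unfolding summable_on_def has_sum_atLeast_1_iff .
    then have "summable h"
      unfolding h_def[abs_def] by (intro summable_mult summable_on_imp_summable)
    then have "summable (\<lambda>n. complex_of_real (h n))"
      by (simp add: summable_of_real)
    moreover have "h n \<ge> 0" for n using d by (simp add: h_def)
    moreover have "norm (t n y) \<le> h n" if "y \<in> ball s d" for n y
    proof -
      have y: "norm (s - y) < d" using that by (simp add: dist_norm)
      have "Re s - Re y \<le> norm (s - y)" using complex_Re_le_cmod[of "s - y"] by simp
      moreover have "norm y \<le> norm s + norm (s - y)"
        using norm_triangle_ineq4[of s "s - y"] by simp
      ultimately show ?thesis
        unfolding t_def h_def using y \<sigma> assms(2)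
        by (intro norm_half_shift_term_le) (auto simp: \<sigma>_def)
    qed
    ultimately show "\<exists>d h. 0 < d \<and> summable h \<and> range h \<subseteq> \<real>\<^sub>\<ge>\<^sub>0 \<and>
        (\<forall>\<^sub>F n in sequentially. \<forall>y\<in>ball s d \<inter> ?S. norm (t n y) \<le> cmod (h n))"
      using d by (intro exI[of _ d] exI[of _ "\<lambda>n. complex_of_real (h n)"])
        (auto intro!: always_eventually)
  qed
  then obtain g g' where g: "\<And>s. s \<in> ?S \<Longrightarrow> (\<lambda>n. t n s) sums g s"
    and g': "\<And>s. s \<in> ?S \<Longrightarrow> (g has_field_derivative g' s) (at s)"
    by blast
  have "g holomorphic_on ?S"
    using g' op by (auto simp: holomorphic_on_open)
  moreover have "g s = dirichlet_half_shift f s" if "s \<in> ?S" for s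
  proof -
    have "(\<lambda>n. t n s) sums dirichlet_half_shift f s"
      unfolding t_def using dirichlet_half_shift_has_sum[OF assms, of s] that
      unfolding has_sum_atLeast_1_iff by (intro has_sum_imp_sums) auto
    with g[OF that] show ?thesis by (rule sums_unique2)
  qed
  ultimately show ?thesis by (rule holomorphic_transform)
qed

text \<open>Expand \<open>(1 + 1 / (2 * n)) powr (-s)\<close> binomially and interchange the sums
  over \<open>n\<close> and \<open>k\<close>. As \<open>k\<close> is at least 1, the double series
  is dominated by a product of two convergent series; the one in \<open>k\<close> converges because
  1/2 lies inside the radius of convergence of the binomial series.\<close>

lemma dirichlet_half_shift_expansion:
  assumes "abs_converges_above c f" "c \<ge> 0" "Re s > c - 1"
  shows "((\<lambda>k. 1 / 2 ^ k * ((-s) gchoose k) * dirichlet f (s + of_nat k))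
           has_sum dirichlet_half_shift f s) {1..}"
proof -
  define b where "b k = 1 / 2 ^ k * ((-s) gchoose k)" for k
  define T where "T = (\<lambda>(n, k). b k * (of_nat n powr (- (s + of_nat k)) * f n))"
  have b_sum: "(\<lambda>k. norm (b k)) summable_on {1..}"
  proof -
    have "summable (\<lambda>k. norm (((-s) gchoose k) * (1/2) ^ k))"
      by (intro abs_summable_in_conv_radius) (simp add: conv_radius_gchoose)
    then have "summable (\<lambda>k. norm (b k))"
      by (simp add: b_def power_divide)
    then have "(\<lambda>k. norm (b k)) summable_on UNIV"
      by (simp add: summable_on_UNIV_nonneg_real_iff)
    then show ?thesis by (rule summable_on_subset_banach) auto
  qed
  have inner: "((\<lambda>k. T (n, k)) has_sum ((of_nat n + 1/2) powr (-s) - of_nat n powr (-s)) * f n) {1..}"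
    if n: "n \<in> {1..}" for n
  proof -
    define z where "z = 1 / (2 * of_nat n :: complex)"
    define u where "u k = ((-s) gchoose k) * z ^ k" for k
    have z: "norm z < 1" using n by (simp add: z_def norm_divide norm_mult)
    have "summable (\<lambda>k. norm (u k))"
      unfolding u_def using z by (intro abs_summable_in_conv_radius) (simp add: conv_radius_gchoose)
    moreover have "u sums (1 + z) powr (-s)"
      unfolding u_def using z by (rule gen_binomial_complex)
    \<comment> \<open>Dropping the term \<open>u 0 = 1\<close> produces the subtracted
      \<open>n powr (-s)\<close>.\<close>
    ultimately have "((\<lambda>k. u (Suc k)) has_sum ((1 + z) powr (-s) - u 0)) UNIV"
      using summable_Suc_iff[of "\<lambda>k. norm (u k)"]
      by (intro norm_summable_imp_has_sum) (simp_all add: sums_Suc_iff)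
    then have "(u has_sum ((1 + z) powr (-s) - 1)) {1..}"
      unfolding has_sum_atLeast_1_iff by (simp add: u_def)
    then have "((\<lambda>k. of_nat n powr (-s) * f n * u k)
        has_sum (of_nat n powr (-s) * f n * ((1 + z) powr (-s) - 1))) {1..}"
      by (rule has_sum_cmult_right)
    moreover have "of_nat n powr (-s) * f n * u k = T (n, k)" for k
    proof -
      have "of_nat n powr (- (s + of_nat k)) = of_nat n powr (-s) / of_nat n ^ k"
        using n by (simp add: powr_diff)
      then show ?thesis
        by (simp add: u_def T_def b_def z_def power_divide power_mult_distrib mult_ac)
    qed
    moreover have "of_nat n powr (-s) * (1 + z) powr (-s) = (of_nat n + 1/2) powr (-s)"
    proof -
      \<comment> \<open>Complex powers are multiplicative here because both bases are nonnegative
        reals.\<close>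
      have "of_nat n powr (-s) * (1 + z) powr (-s) = (of_nat n * (1 + z)) powr (-s)"
        by (rule powr_times_real[symmetric]) (auto simp: z_def)
      also have "of_nat n * (1 + z) = of_nat n + 1/2"
        using n by (simp add: z_def field_simps)
      finally show ?thesis .
    qed
    then have "of_nat n powr (-s) * f n * ((1 + z) powr (-s) - 1)
        = ((of_nat n + 1/2) powr (-s) - of_nat n powr (-s)) * f n"
      by (simp add: algebra_simps)
    ultimately show ?thesis by simp
  qed
  have "T summable_on {1..} \<times> {1..}"
  proof (rule abs_summable_summable, rule Infinite_Sum.abs_summable_on_comparison_test')
    have w: "(\<lambda>n. real n powr (- (Re s + 1)) * norm (f n)) summable_on {1..}"
      using assms by (intro abs_converges_aboveD) auto
    show "(\<lambda>(n, k). norm (b k) * (real n powr (- (Re s + 1)) * norm (f n))) summable_on {1..} \<times> {1..}"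
    proof (rule summable_on_SigmaI)
      show "((\<lambda>k. case (n, k) of (n, k) \<Rightarrow> norm (b k) * (real n powr (- (Re s + 1)) * norm (f n)))
          has_sum (infsum (\<lambda>k. norm (b k)) {1..} * (real n powr (- (Re s + 1)) * norm (f n)))) {1..}" for n
        unfolding prod.case using b_sum by (intro has_sum_cmult_left has_sum_infsum)
    qed (use w in \<open>auto intro: summable_on_cmult_right\<close>)
  next
    fix p :: "nat \<times> nat" assume p: "p \<in> {1..} \<times> {1..}"
    obtain n k where nk: "p = (n, k)" "n \<ge> 1" "k \<ge> 1" using p by auto
    have "norm (T p) = norm (b k) * (real n powr (- (Re s + real k)) * norm (f n))"
      by (simp add: T_def nk(1) norm_mult norm_powr_real_powr)
    also have "\<dots> \<le> norm (b k) * (real n powr (- (Re s + 1)) * norm (f n))"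
      using nk by (intro mult_left_mono mult_right_mono powr_mono) auto
    finally show "norm (T p) \<le> (case p of (n, k) \<Rightarrow> norm (b k) * (real n powr (- (Re s + 1)) * norm (f n)))"
      by (simp add: nk(1))
  qed
  then obtain S where S: "(T has_sum S) ({1..} \<times> {1..})" by (auto simp: summable_on_def)
  \<comment> \<open>Summing first over \<open>k\<close> gives the half shift; summing first over
    \<open>n\<close>, further below, gives the series in \<open>k\<close>.\<close>
  have "((\<lambda>n. ((of_nat n + 1/2) powr (-s) - of_nat n powr (-s)) * f n) has_sum S) {1..}"
    using S inner by (rule has_sum_SigmaD)
  then have "S = dirichlet_half_shift f s"
    using dirichlet_half_shift_has_sum[OF assms] by (rule has_sum_unique)
  moreover have "((\<lambda>k. b k * dirichlet f (s + of_nat k)) has_sum S) {1..}"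
  proof (rule has_sum_SigmaD)
    show "((\<lambda>(k, n). T (n, k)) has_sum S) ({1..} \<times> {1..})"
      using S by (subst (asm) has_sum_swap)
    fix k :: nat assume "k \<in> {1..}"
    then show "((\<lambda>n. case (k, n) of (k, n) \<Rightarrow> T (n, k)) has_sum b k * dirichlet f (s + of_nat k)) {1..}"
      unfolding T_def prod.case using assms
      by (intro has_sum_cmult_right dirichlet_has_sum[where c = c]) auto
  qed
  ultimately show ?thesis by (simp add: b_def)
qed

text \<open>At odd arguments \<open>(2 * n + 1) powr (-s)\<close> is
  \<open>2 powr (-s) * (n + 1/2) powr (-s)\<close>, and the last factor is
  \<open>n powr (-s)\<close> plus the term of the half shift.\<close>

lemma dirichlet_even_odd:
  assumes "abs_converges_above c (\<lambda>n. f (2 * n))" "abs_converges_above c (\<lambda>n. f (2 * n + 1))"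
    and "c \<ge> 0" "Re s > c"
  shows "dirichlet f s = f 1 + 2 powr (-s) * (dirichlet (\<lambda>n. f (2 * n)) s
           + dirichlet (\<lambda>n. f (2 * n + 1)) s + dirichlet_half_shift (\<lambda>n. f (2 * n + 1)) s)"
proof -
  let ?A = "dirichlet (\<lambda>n. f (2 * n)) s"
  let ?B = "dirichlet (\<lambda>n. f (2 * n + 1)) s + dirichlet_half_shift (\<lambda>n. f (2 * n + 1)) s"
  have "((\<lambda>n. 2 powr (-s) * (of_nat n powr (-s) * f (2 * n))) has_sum 2 powr (-s) * ?A) {1..}"
    using assms by (intro has_sum_cmult_right dirichlet_has_sum)
  moreover have "2 powr (-s) * of_nat n powr (-s) = of_nat (2 * n) powr (-s)" for n
    using powr_times_real[of 2 "of_nat n" "-s"] by simp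
  ultimately have "((\<lambda>n. of_nat (2 * n) powr (-s) * f (2 * n)) has_sum 2 powr (-s) * ?A) {1..}"
    by (simp flip: mult.assoc)
  moreover have "((\<lambda>n. of_nat (2 * n + 1) powr (-s) * f (2 * n + 1)) has_sum 2 powr (-s) * ?B) {1..}"
  proof -
    have "((\<lambda>n. 2 powr (-s) * (of_nat n powr (-s) * f (2 * n + 1)
        + ((of_nat n + 1/2) powr (-s) - of_nat n powr (-s)) * f (2 * n + 1))) has_sum 2 powr (-s) * ?B) {1..}"
      using assms by (intro has_sum_cmult_right has_sum_add dirichlet_has_sum dirichlet_half_shift_has_sum) auto
    moreover have "2 powr (-s) * (of_nat n + 1/2) powr (-s) = of_nat (2 * n + 1) powr (-s)" for n
      using powr_times_real[of 2 "of_nat n + 1/2" "-s"] by (simp add: algebra_simps)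
    then have "2 powr (-s) * (of_nat n powr (-s) * f (2 * n + 1)
        + ((of_nat n + 1/2) powr (-s) - of_nat n powr (-s)) * f (2 * n + 1))
      = of_nat (2 * n + 1) powr (-s) * f (2 * n + 1)" for n
      by (simp add: ring_distribs flip: mult.assoc)
    ultimately show ?thesis by (simp only:)
  qed
  ultimately have "((\<lambda>n. of_nat n powr (-s) * f n) has_sum
      (of_nat 1 powr (-s) * f 1 + 2 powr (-s) * ?A + 2 powr (-s) * ?B)) {1..}"
    by (rule has_sum_even_odd)
  then show ?thesis
    unfolding dirichlet_def[of f] by (simp add: infsumI algebra_simps)
qed

subsection \<open>The Dirichlet series of Stern's sequence\<close>

text \<open>The weight \<open>w n\<close> satisfies
  \<open>w (2 * n) + w (2 * n + 1) = 3 * w n\<close>. Grouping the terms in such pairs bounds a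
  partial sum by \<open>t 1\<close> plus \<open>q\<close> times one of half the length, with
  \<open>q = 3 * 2 powr (-\<sigma>) < 1\<close>.\<close>

lemma stern_weight_abs_converges:
  "abs_converges_above (log 2 3) (\<lambda>n. of_int (stern n + stern (n + 1)))"
  unfolding abs_converges_above_def
proof (intro allI impI)
  fix \<sigma> :: real assume \<sigma>: "\<sigma> > log 2 3"
  define w where "w n = real_of_int (stern n + stern (n + 1))" for n
  define t where "t n = real n powr (-\<sigma>) * w n" for n
  define q where "q = 3 * 2 powr (-\<sigma>)"
  define S where "S N = (\<Sum>n=1..<N. t n)" for N
  have "log 2 3 > (0::real)" by simp
  with \<sigma> have "\<sigma> > 0" by linarith
  have w: "w n \<ge> 0" for n using stern_nonneg by (simp add: w_def)
  have w_double: "w (2 * n) + w (2 * n + 1) = 3 * w n" for n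
    using stern_even[of n] stern_odd[of n] stern_even[of "n + 1"] by (simp add: w_def)
  have t: "t n \<ge> 0" for n using w by (simp add: t_def)
  have q: "q < 1"
  proof -
    have "(3::real) = 2 powr log 2 3" by simp
    also have "\<dots> < 2 powr \<sigma>" using \<sigma> by (intro powr_less_mono) auto
    finally show ?thesis by (simp add: q_def powr_minus field_simps)
  qed
  have step: "t (2 * n) + t (2 * n + 1) \<le> q * t n" if "n \<ge> 1" for n
  proof -
    have "real (2 * n + 1) powr (-\<sigma>) \<le> real (2 * n) powr (-\<sigma>)"
      using that \<open>\<sigma> > 0\<close> by (intro powr_mono2') auto
    then have "t (2 * n) + t (2 * n + 1) \<le> real (2 * n) powr (-\<sigma>) * (w (2 * n) + w (2 * n + 1))"
      using w[of "2 * n"] w[of "2 * n + 1"] unfolding t_def distrib_left by (intro add_mono mult_right_mono) auto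
    also have "\<dots> = q * t n"
      unfolding w_double by (simp add: q_def t_def powr_mult)
    finally show ?thesis .
  qed
  have S_double: "S (2 * Suc N) \<le> t 1 + q * S (Suc N)" for N
  proof (induction N)
    case (Suc N)
    have "S (2 * Suc (Suc N)) = S (2 * Suc N) + (t (2 * Suc N) + t (2 * Suc N + 1))"
      by (simp add: S_def)
    also have "\<dots> \<le> (t 1 + q * S (Suc N)) + q * t (Suc N)"
      using Suc.IH by (intro add_mono step) auto
    also have "\<dots> = t 1 + q * S (Suc (Suc N))"
      by (simp add: S_def algebra_simps)
    finally show ?case .
  qed (simp add: S_def numeral_2_eq_2)
  have S_bound: "S N \<le> t 1 / (1 - q)" for N
  proof -
    have mono: "S M \<le> S (2 * Suc N)" if "M \<le> 2 * Suc N" for M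
      unfolding S_def using t that by (intro sum_mono2) auto
    \<comment> \<open>Enlarging the sum on the right puts the same finite quantity on both sides, so
      \<open>q < 1\<close> allows solving for it.\<close>
    have "S (2 * Suc N) \<le> t 1 + q * S (2 * Suc N)"
      using S_double[of N] mono[of "Suc N"]
      by (smt (verit) mult_left_mono powr_ge_zero q_def le_add2 mult_2)
    then have "S (2 * Suc N) \<le> t 1 / (1 - q)"
      using q by (simp add: field_simps)
    with mono[of N] show ?thesis by simp
  qed
  have "t summable_on {1..}"
  proof (rule nonneg_bdd_above_summable_on)
    show "bdd_above (sum t ` {F. F \<subseteq> {1..} \<and> finite F})"
    proof (rule bdd_aboveI2)
      fix F assume F: "F \<in> {F. F \<subseteq> {1::nat..} \<and> finite F}"
      then have "F \<subseteq> {1..<Suc (Max F)}" by (auto simp: less_Suc_eq_le)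
      then have "sum t F \<le> S (Suc (Max F))"
        unfolding S_def using t by (intro sum_mono2) auto
      then show "sum t F \<le> t 1 / (1 - q)"
        using S_bound[of "Suc (Max F)"] by linarith
    qed
  qed (use t in auto)
  moreover have "norm (of_int (stern n + stern (n + 1)) :: complex) = w n" for n
    unfolding w_def norm_of_int using w[of n] unfolding w_def by simp
  ultimately show "(\<lambda>n. real n powr (-\<sigma>) * norm (of_int (stern n + stern (n + 1)) :: complex)) summable_on {1..}"
    by (simp only: t_def[abs_def])
qed

lemma stern_abs_converges:
  "abs_converges_above (log 2 3) (\<lambda>n. of_int (stern n))"
  "abs_converges_above (log 2 3) (\<lambda>n. of_int (stern (n + 1)))"
proof -
  have *: "abs_converges_above (log 2 3) (\<lambda>n. of_int (f n))"
    if "\<And>n. 0 \<le> f n" "\<And>n. f n \<le> stern n + stern (n + 1)" for f :: "nat \<Rightarrow> int"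
    unfolding abs_converges_above_def
  proof (intro allI impI)
    fix \<sigma> :: real assume \<sigma>: "\<sigma> > log 2 3"
    have "norm (of_int (f n) :: complex) \<le> norm (of_int (stern n + stern (n + 1)) :: complex)" for n
      unfolding norm_of_int using that(1)[of n] that(2)[of n] by simp
    then show "(\<lambda>n. real n powr (-\<sigma>) * norm (of_int (f n) :: complex)) summable_on {1..}"
      by (intro summable_on_comparison_test[OF abs_converges_aboveD[OF stern_weight_abs_converges \<sigma>]]
          mult_left_mono) auto
  qed
  show "abs_converges_above (log 2 3) (\<lambda>n. of_int (stern n))"
    "abs_converges_above (log 2 3) (\<lambda>n. of_int (stern (n + 1)))"
    by (intro *; use stern_nonneg in simp)+
qed

section \<open>The linear system for the two Dirichlet series\<close>

definition stern_domain :: "complex set" where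
  "stern_domain = {s. Re s > log 2 golden_ratio}"

text \<open>The first bound excludes zeros of \<open>1 - 2 powr (-s)\<close>; the second gives
  convergence of the half shifts and comes from \<open>stern_exponent_le_1\<close>.\<close>

lemma stern_domain_bounds:
  assumes "s \<in> stern_domain"
  shows "Re s > 0" "Re s > log 2 3 - 1"
proof -
  note g = golden_ratio_gt_1
  have "0 < log 2 golden_ratio" using g by simp
  then show "Re s > 0" using assms by (simp add: stern_domain_def)
  show "Re s > log 2 3 - 1"
    using assms stern_exponent_le_1 by (simp add: stern_domain_def stern_exponent_def)
qed

lemma open_stern_domain: "open stern_domain"
  unfolding stern_domain_def by (rule open_halfspace_Re_gt)

definition stern_dirichlet :: "2 \<Rightarrow> complex \<Rightarrow> complex" where
  "stern_dirichlet i = dirichlet (\<lambda>n. stern_vec n $ i)"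

definition stern_half_shift :: "2 \<Rightarrow> complex \<Rightarrow> complex" where
  "stern_half_shift i = dirichlet_half_shift (\<lambda>n. stern_vec n $ i)"

lemma stern_vec_nth [simp]:
  "stern_vec n $ 1 = of_int (stern n)" "stern_vec n $ 2 = of_int (stern (n + 1))"
  by (simp_all add: stern_vec_def)

lemma stern_vec_abs_converges: "abs_converges_above (log 2 3) (\<lambda>n. stern_vec n $ i)"
  using stern_abs_converges exhaust_2[of i] by auto

text \<open>The right-hand side of the functional equation by components, with the sum over
  \<open>k\<close> already evaluated. The 1 is either entry of \<open>stern_vec 1\<close>, and the
  case distinction is the action of \<open>stern_A1\<close>.\<close>

definition stern_source :: "2 \<Rightarrow> complex \<Rightarrow> complex" where
  "stern_source i s = 1 + 2 powr (-s) *
     (if i = 1 then stern_half_shift 1 s + stern_half_shift 2 s else stern_half_shift 2 s)"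

text \<open>
  The matrix \<open>I - z C\<close> with \<open>z = 2 powr (-s)\<close> has determinant \<open>(1 - z) * (1 - 3 * z)\<close>; the factor \<open>1 - z\<close>
  has no zero with \<open>Re s > 0\<close>, so Cramer's rule leaves \<open>1 - 3 * z\<close> as the only relevant denominator.
\<close>

definition stern_numerator :: "2 \<Rightarrow> complex \<Rightarrow> complex" where
  "stern_numerator i s = ((1 - 2 * 2 powr (-s)) * stern_source i s + 2 powr (-s) * stern_source (if i = 1 then 2 else 1) s)
                   / (1 - 2 powr (-s))"

definition stern_denominator :: "complex \<Rightarrow> complex" where
  "stern_denominator s = 1 - 3 * 2 powr (-s)"

text \<open>By the recurrence, both components of \<open>stern_vec\<close> restricted to even or odd
  indices are again sums of these components, so the parity splitting closes up to a system with
  matrix \<open>stern_C\<close>.\<close>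

lemma stern_dirichlet_equation:
  assumes "Re s > log 2 3"
  shows "(1 - 2 * 2 powr (-s)) * stern_dirichlet 1 s - 2 powr (-s) * stern_dirichlet 2 s = stern_source 1 s"
    and "(1 - 2 * 2 powr (-s)) * stern_dirichlet 2 s - 2 powr (-s) * stern_dirichlet 1 s = stern_source 2 s"
proof -
  let ?a = "\<lambda>n. of_int (stern n) :: complex" and ?b = "\<lambda>n. of_int (stern (n + 1)) :: complex"
  let ?c = "\<lambda>n. ?a n + ?b n"
  note conv = stern_abs_converges abs_converges_above_add[OF stern_abs_converges]
  have k: "log 2 3 \<ge> (0::real)" "Re s > log 2 3 - 1" using assms by auto
  have a_even: "?a (2 * n) = ?a n" and a_odd: "?a (2 * n + 1) = ?c n"
    and b_even: "?b (2 * n) = ?c n" and b_odd: "?b (2 * n + 1) = ?b n" for n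
    using stern_even[of n] stern_odd[of n] stern_even[of "n + 1"] by simp_all
  have sums: "dirichlet ?c s = stern_dirichlet 1 s + stern_dirichlet 2 s"
    "dirichlet_half_shift ?c s = stern_half_shift 1 s + stern_half_shift 2 s"
    unfolding stern_dirichlet_def stern_half_shift_def stern_vec_nth
    by (rule dirichlet_add[OF stern_abs_converges assms]
             dirichlet_half_shift_add[OF stern_abs_converges k])+
  have "stern_dirichlet 1 s = 1 + 2 powr (-s) * (dirichlet ?a s + dirichlet ?c s + dirichlet_half_shift ?c s)"
    using dirichlet_even_odd[of "log 2 3" ?a s] conv assms k unfolding a_even a_odd
    by (simp add: stern_dirichlet_def)
  then show "(1 - 2 * 2 powr (-s)) * stern_dirichlet 1 s - 2 powr (-s) * stern_dirichlet 2 s = stern_source 1 s"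
    unfolding sums stern_source_def by (simp add: stern_dirichlet_def algebra_simps)
  have "stern_dirichlet 2 s = 1 + 2 powr (-s) * (dirichlet ?c s + dirichlet ?b s + dirichlet_half_shift ?b s)"
    using dirichlet_even_odd[of "log 2 3" ?b s] conv assms k unfolding b_even b_odd
    by (simp add: stern_dirichlet_def)
  then show "(1 - 2 * 2 powr (-s)) * stern_dirichlet 2 s - 2 powr (-s) * stern_dirichlet 1 s = stern_source 2 s"
    unfolding sums stern_source_def by (simp add: stern_dirichlet_def stern_half_shift_def algebra_simps)
qed

lemma two_powr_neq_1: "Re s > 0 \<Longrightarrow> 2 powr (-s) \<noteq> (1::complex)"
proof
  assume "Re s > 0" "2 powr (-s) = (1::complex)"
  then have "2 powr (- Re s) = (1::real)"
    using norm_powr_real_powr[of 2 "-s"] by simp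
  with \<open>Re s > 0\<close> show False by simp
qed

lemma stern_denominator_nonzero:
  assumes "Re s > log 2 3"
  shows "stern_denominator s \<noteq> 0"
proof
  assume "stern_denominator s = 0"
  then have "2 powr (-s) = (1/3 :: complex)" by (simp add: stern_denominator_def eq_divide_eq mult.commute)
  from arg_cong[OF this, of norm] have "2 powr (- Re s) = (1/3 :: real)"
    by (simp add: norm_powr_real_powr norm_divide)
  then have "2 powr Re s = (3::real)" by (simp add: powr_minus field_simps)
  then have "Re s = log 2 3" using log_powr_cancel[of 2 "Re s"] by simp
  with assms show False by simp
qed

lemma stern_denominator_zeroE:
  assumes "stern_denominator s = 0"
  shows "\<exists>\<mu> :: int. s = of_real (log 2 3) + 2 * of_real pi * \<i> * of_int \<mu> / of_real (ln 2)"
proof -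
  have "exp (s * of_real (ln 2)) * 2 powr (-s) = (1 :: complex)"
    by (simp add: powr_def flip: exp_add Ln_of_real)
  moreover have "3 * 2 powr (-s) = (1 :: complex)"
    using assms by (simp add: stern_denominator_def)
  ultimately have "exp (s * of_real (ln 2)) * 2 powr (-s) = 3 * (2 powr (-s) :: complex)" by simp
  then have "exp (s * of_real (ln 2)) = (3 :: complex)" by simp
  also have "3 = exp (complex_of_real (ln 3))"
    by (simp add: exp_of_real)
  finally obtain n :: int where "s * of_real (ln 2) = of_real (ln 3) + of_int (2 * n) * (of_real pi * \<i>)"
    by (auto simp: exp_eq)
  then have "s = of_real (log 2 3) + 2 * of_real pi * \<i> * of_int n / of_real (ln 2)"
    by (simp add: log_def field_simps)
  then show ?thesis ..
qed

lemma stern_dirichlet_eq: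
  assumes "Re s > log 2 3"
  shows "stern_dirichlet i s = stern_numerator i s / stern_denominator s"
proof -
  have "log 2 3 > (0::real)" by simp
  then have "Re s > 0" using assms by linarith
  then have z: "1 - 2 powr (-s) \<noteq> 0" "stern_denominator s \<noteq> 0"
    using two_powr_neq_1[of s] stern_denominator_nonzero[OF assms] by auto
  have "stern_dirichlet j s * stern_denominator s * (1 - 2 powr (-s))
      = (1 - 2 * 2 powr (-s)) * stern_source j s + 2 powr (-s) * stern_source (if j = 1 then 2 else 1) s" for j :: 2
    using exhaust_2[of j] unfolding stern_dirichlet_equation[OF assms, symmetric] stern_denominator_def
    by (auto simp: stern_dirichlet_equation[OF assms, symmetric] algebra_simps)
  then show ?thesis using z by (simp add: stern_numerator_def field_simps)
qed

section \<open>Analyticity, and the zeros of the denominator\<close>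

lemma stern_half_shift_analytic: "stern_half_shift i analytic_on stern_domain"
proof -
  have "stern_half_shift i holomorphic_on {s. Re s > log 2 3 - 1}"
    unfolding stern_half_shift_def by (rule dirichlet_half_shift_holomorphic[OF stern_vec_abs_converges]) simp
  then have "stern_half_shift i holomorphic_on stern_domain"
    by (rule holomorphic_on_subset) (use stern_domain_bounds in auto)
  then show ?thesis by (simp add: analytic_on_open open_stern_domain)
qed

lemma two_powr_analytic: "(\<lambda>s::complex. 2 powr (-s)) analytic_on A"
  by (rule analytic_on_subset[of _ UNIV]) (auto simp: analytic_on_open intro!: holomorphic_intros)

lemma stern_source_analytic: "stern_source i analytic_on stern_domain"
  unfolding stern_source_def
  by (cases "i = 1") (auto intro!: analytic_intros stern_half_shift_analytic two_powr_analytic)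

lemma stern_numerator_analytic: "stern_numerator i analytic_on stern_domain"
  unfolding stern_numerator_def using two_powr_neq_1 stern_domain_bounds
  by (intro analytic_intros stern_source_analytic two_powr_analytic) force

lemma stern_denominator_analytic: "stern_denominator analytic_on A"
  unfolding stern_denominator_def by (intro analytic_intros two_powr_analytic)

lemma stern_denominator_eventually_nonzero: "eventually (\<lambda>w. stern_denominator w \<noteq> 0) (at s)"
proof -
  have "stern_denominator holomorphic_on UNIV" using stern_denominator_analytic by (rule analytic_imp_holomorphic)
  \<comment> \<open>The point 0, where the value is -2, shows that the function is not constantly
    zero; its zeros are therefore isolated.\<close>
  then have "eventually (\<lambda>w. stern_denominator w \<noteq> 0 \<and> w \<in> UNIV) (at s)"
    by (rule non_zero_neighbour_alt[where \<beta> = 0]) (auto simp: stern_denominator_def)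
  then show ?thesis by simp
qed

text \<open>The derivative \<open>3 * Ln 2 * 2 powr (-s)\<close> never vanishes, so all zeros are
  simple.\<close>

lemma zorder_stern_denominator:
  assumes "stern_denominator s = 0"
  shows "zorder stern_denominator s = 1"
proof (rule zorder_zero_eqI'[OF stern_denominator_analytic])
  have "((\<lambda>w. 2 powr (-w)) has_field_derivative (Ln 2 * 2 powr (-s)) * (-1)) (at s)"
    by (rule DERIV_chain2[OF has_field_derivative_powr_right]) (auto intro!: derivative_eq_intros)
  then have "(stern_denominator has_field_derivative 3 * (Ln 2 * 2 powr (-s))) (at s)"
    unfolding stern_denominator_def by (auto intro!: derivative_eq_intros)
  then have "deriv stern_denominator s = 3 * (Ln 2 * 2 powr (-s))" by (rule DERIV_imp_deriv)
  moreover have "Ln 2 \<noteq> 0" using Ln_of_real[of 2] by simp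
  ultimately have "deriv stern_denominator s \<noteq> 0" by simp
  then show "(deriv ^^ nat 1) stern_denominator s \<noteq> 0" by simp
qed (use assms in auto)

text \<open>Where numerator and denominator vanish together, division by zero would give the value
  0; \<open>remove_sings\<close> gives the limit instead, and the value 0 at genuine poles, as
  \<open>nicely_meromorphic_on\<close> requires.\<close>

definition stern_V :: "complex \<Rightarrow> complex ^ 2" where
  "stern_V s = (\<chi> i. remove_sings (\<lambda>w. stern_numerator i w / stern_denominator w) s)"

lemma stern_V_eq:
  assumes "s \<in> stern_domain" "stern_denominator s \<noteq> 0"
  shows "stern_V s $ i = stern_numerator i s / stern_denominator s"
proof -
  have "(\<lambda>w. stern_numerator i w / stern_denominator w) analytic_on {s}"
    using assms by (intro analytic_intros stern_denominator_analytic analytic_on_subset[OF stern_numerator_analytic]) auto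
  then show ?thesis by (simp add: stern_V_def)
qed

lemma stern_V_eq_dirichlet:
  assumes "s \<in> stern_domain" "Re s > log 2 3"
  shows "stern_V s $ i = stern_dirichlet i s"
  using assms by (simp add: stern_V_eq stern_denominator_nonzero stern_dirichlet_eq)

lemma stern_quotient_meromorphic: "(\<lambda>w. stern_numerator i w / stern_denominator w) meromorphic_on stern_domain"
  by (intro meromorphic_intros analytic_on_imp_meromorphic_on stern_numerator_analytic stern_denominator_analytic)

lemma stern_V_nicely_meromorphic: "(\<lambda>s. stern_V s $ i) nicely_meromorphic_on stern_domain"
  unfolding stern_V_def vec_lambda_beta
  by (rule remove_sings_nicely_meromorphic[OF stern_quotient_meromorphic])

text \<open>The numerator has nonnegative order and the denominator order 1 at its zeros, so the
  quotient has order at least -1; at a pole the order is negative.\<close>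

lemma stern_V_pole:
  assumes "s \<in> stern_domain" "is_pole (\<lambda>z. stern_V z $ i) s"
  shows "zorder (\<lambda>z. stern_V z $ i) s = -1" "stern_denominator s = 0"
proof -
  let ?f = "\<lambda>w. stern_numerator i w / stern_denominator w"
  have mer: "?f meromorphic_on {s}"
    using stern_quotient_meromorphic by (rule meromorphic_on_subset) (use assms in auto)
  have iso: "isolated_singularity_at ?f s"
    using mer by (auto intro: meromorphic_on_isolated_singularity)
  have pole: "is_pole ?f s"
    using assms(2) iso by (simp add: stern_V_def)
  have N: "stern_numerator i analytic_on {s}" using assms(1) by (intro analytic_on_subset[OF stern_numerator_analytic]) auto
  show q: "stern_denominator s = 0"
  proof (rule ccontr)
    assume "stern_denominator s \<noteq> 0"
    then have "?f analytic_on {s}" using N by (intro analytic_intros stern_denominator_analytic) auto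
    with pole show False using analytic_at_imp_no_pole by blast
  qed
  \<comment> \<open>The order of a quotient is additive only if the numerator is not locally zero;
    if it were, the quotient would tend to 0 and have no pole.\<close>
  have freq: "\<exists>\<^sub>F w in at s. stern_numerator i w \<noteq> 0"
  proof (rule ccontr)
    assume "\<not> ?thesis"
    then have "\<forall>\<^sub>F w in at s. stern_numerator i w = 0" by (simp add: frequently_def)
    then have "\<forall>\<^sub>F w in at s. ?f w = 0" by eventually_elim simp
    then have "?f \<midarrow>s\<rightarrow> 0" by (rule tendsto_eventually)
    with pole show False
      unfolding is_pole_def using not_tendsto_and_filterlim_at_infinity[of "at s"] by auto
  qed
  have "zorder ?f s = zorder (stern_numerator i) s - zorder stern_denominator s"
    by (rule zorder_divide)
       (use N freq stern_denominator_eventually_nonzero[of s] in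
        \<open>auto intro!: analytic_on_imp_meromorphic_on stern_denominator_analytic eventually_frequently\<close>)
  moreover have "zorder ?f s < 0"
    using iso pole by (rule isolated_pole_imp_neg_zorder)
  moreover have "zorder (stern_numerator i) s \<ge> 0"
    using N freq by (rule zorder_ge_0)
  moreover have "zorder (\<lambda>z. stern_V z $ i) s = zorder ?f s"
    unfolding stern_V_def vec_lambda_beta using iso by simp
  ultimately show "zorder (\<lambda>z. stern_V z $ i) s = -1"
    using zorder_stern_denominator[OF q] by linarith
qed

section \<open>The functional equation for the continued function\<close>

lemma stern_V_has_sum:
  assumes "Re s > log 2 3"
  shows "((\<lambda>n :: nat. (of_nat n powr (- s)) *s stern_vec n) has_sum stern_V s) {1..}"
proof (rule has_sum_vecI)
  fix i :: 2
  have "golden_ratio < 3" using golden_ratio_less_2 by simp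
  then have "log 2 golden_ratio < log 2 3" using golden_ratio_gt_1 by simp
  then have "s \<in> stern_domain" using assms by (simp add: stern_domain_def)
  then show "((\<lambda>n. (of_nat n powr (-s) *s stern_vec n) $ i) has_sum stern_V s $ i) {1..}"
    using dirichlet_has_sum[OF stern_vec_abs_converges assms] assms
    by (simp add: stern_V_eq_dirichlet stern_dirichlet_def)
qed

text \<open>Since \<open>Re s > log 2 3 - 1\<close>, every \<open>s + k\<close> with positive
  \<open>k\<close> lies in the half-plane of absolute convergence. There \<open>stern_V\<close> is
  the Dirichlet series itself and the binomial expansion applies.\<close>

lemma stern_rhs_term_has_sum:
  assumes "s \<in> stern_domain"
  shows "(stern_rhs_term stern_V s has_sum (\<chi> i. stern_half_shift i s)) {1..}"
proof (rule has_sum_vecI)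
  fix i :: 2
  have sum: "((\<lambda>k. 1 / 2 ^ k * ((-s) gchoose k) * stern_dirichlet i (s + of_nat k)) has_sum stern_half_shift i s) {1..}"
    unfolding stern_dirichlet_def stern_half_shift_def using stern_domain_bounds[OF assms]
    by (intro dirichlet_half_shift_expansion[OF stern_vec_abs_converges]) auto
  have eq: "1 / 2 ^ k * ((-s) gchoose k) * stern_dirichlet i (s + of_nat k) = stern_rhs_term stern_V s k $ i"
    if "k \<in> {1..}" for k
  proof -
    have "s + of_nat k \<in> stern_domain" "Re (s + of_nat k) > log 2 3"
      using stern_domain_bounds[OF assms] assms that by (auto simp: stern_domain_def)
    then show ?thesis by (simp add: stern_rhs_term_def stern_V_eq_dirichlet)
  qed
  show "((\<lambda>k. stern_rhs_term stern_V s k $ i) has_sum (\<chi> i. stern_half_shift i s) $ i) {1..}"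
    using sum by (simp only: has_sum_cong[OF eq] vec_lambda_beta)
qed

lemma stern_rhs_eq:
  assumes "s \<in> stern_domain"
  shows "stern_rhs stern_V s $ i = stern_source i s"
proof -
  show ?thesis
    using exhaust_2[of i] infsumI[OF stern_rhs_term_has_sum[OF assms]]
    by (auto simp: stern_rhs_def stern_source_def stern_A1_def matrix_vector_mult_def sum_2 stern_vec_def)
qed

lemma stern_lhs_nth:
  "stern_lhs V s $ 1 = (1 - 2 * 2 powr (-s)) * V s $ 1 - 2 powr (-s) * V s $ 2"
  "stern_lhs V s $ 2 = (1 - 2 * 2 powr (-s)) * V s $ 2 - 2 powr (-s) * V s $ 1"
  by (simp_all add: stern_lhs_def stern_C_def mat_def matrix_matrix_mult_def matrix_vector_mult_def sum_2
      algebra_simps)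

text \<open>Beyond the half-plane of convergence the equation is pure algebra:
  \<open>stern_V\<close> is given by Cramer's rule, and both sides agree after multiplication by the
  nonzero determinant.\<close>

lemma stern_lhs_eq:
  assumes "s \<in> stern_domain" "stern_denominator s \<noteq> 0"
  shows "stern_lhs stern_V s $ i = stern_source i s"
proof -
  let ?z = "2 powr (-s) :: complex"
  have z: "1 - ?z \<noteq> 0" using two_powr_neq_1[OF stern_domain_bounds(1)[OF assms(1)]] by simp
  have *: "stern_V s $ j * (stern_denominator s * (1 - ?z)) 
      = (1 - 2 * ?z) * stern_source j s + ?z * stern_source (if j = 1 then 2 else 1) s" for j
    using z assms by (simp add: stern_V_eq stern_numerator_def)
  have a: "stern_V s $ 1 * (stern_denominator s * (1 - ?z)) = (1 - 2 * ?z) * stern_source 1 s + ?z * stern_source 2 s"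
    "stern_V s $ 2 * (stern_denominator s * (1 - ?z)) = (1 - 2 * ?z) * stern_source 2 s + ?z * stern_source 1 s"
    using *[of 1] *[of 2] by simp_all
  consider "i = 1" | "i = 2" using exhaust_2[of i] by blast
  then have "stern_lhs stern_V s $ i * (stern_denominator s * (1 - ?z))
      = stern_source i s * (stern_denominator s * (1 - ?z))"
  proof cases
    case 1
    show ?thesis
      unfolding 1 stern_lhs_nth left_diff_distrib mult.assoc a by (simp add: stern_denominator_def algebra_simps)
  next
    case 2
    show ?thesis
      unfolding 2 stern_lhs_nth left_diff_distrib mult.assoc a by (simp add: stern_denominator_def algebra_simps)
  qed
  then show ?thesis using z assms by simp
qed

text \<open>A punctured neighbourhood avoids the zeros of the denominator, so the limit exists even
  at poles of \<open>stern_V\<close> and is the value of the continuous source.\<close>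

lemma stern_lhs_tendsto:
  assumes "s \<in> stern_domain"
  shows "(\<lambda>w. stern_lhs stern_V w $ i) \<midarrow>s\<rightarrow> stern_source i s"
proof -
  have "isCont (stern_source i) s"
    using stern_source_analytic assms analytic_at_imp_isCont analytic_on_analytic_at by blast
  then have "stern_source i \<midarrow>s\<rightarrow> stern_source i s" by (simp add: isCont_def)
  moreover have "\<forall>\<^sub>F w in at s. stern_source i w = stern_lhs stern_V w $ i"
    using stern_denominator_eventually_nonzero eventually_at_in_open'[OF open_stern_domain assms]
    by eventually_elim (simp add: stern_lhs_eq)
  ultimately show ?thesis by (rule Lim_transform_eventually)
qed

text \<open>This includes zeros of the denominator at which the singularity is removable: there
  \<open>stern_V\<close> is continuous, and uniqueness of limits transfers the equation from the
  punctured neighbourhood.\<close>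

lemma stern_lhs_eq_rhs:
  assumes "s \<in> stern_domain" "\<And>i. \<not> is_pole (\<lambda>z. stern_V z $ i) s"
  shows "stern_lhs stern_V s = stern_rhs stern_V s"
proof -
  have V: "(\<lambda>z. stern_V z $ i) \<midarrow>s\<rightarrow> stern_V s $ i" for i
    using nicely_meromorphic_on_imp_analytic_at[OF stern_V_nicely_meromorphic assms]
      analytic_at_imp_isCont isContD by blast
  have P: "(\<lambda>w. 2 powr (-w)) \<midarrow>s\<rightarrow> (2 powr (-s) :: complex)"
    using analytic_at_imp_isCont[OF two_powr_analytic] isContD by blast
  have "(\<lambda>w. stern_lhs stern_V w $ i) \<midarrow>s\<rightarrow> stern_lhs stern_V s $ i" for i
    using exhaust_2[of i] by (elim disjE; simp only: stern_lhs_nth; intro tendsto_intros V P)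
  then have "stern_lhs stern_V s $ i = stern_source i s" for i
    using stern_lhs_tendsto[OF assms(1), of i] by (rule tendsto_unique[rotated]) simp
  then show ?thesis using assms(1) by (simp add: vec_eq_iff stern_rhs_eq)
qed

lemma remove_sings_stern_lhs:
  assumes "s \<in> stern_domain"
  shows "remove_sings (\<lambda>z. stern_lhs stern_V z $ i) s = stern_rhs stern_V s $ i"
  using remove_sings_eqI[OF stern_lhs_tendsto[OF assms]] assms by (simp add: stern_rhs_eq)

lemma stern_rhs_analytic: "(\<lambda>s. stern_rhs stern_V s $ i) analytic_on stern_domain"
  using stern_source_analytic[of i] unfolding analytic_on_open[OF open_stern_domain]
  by (rule holomorphic_transform) (simp add: stern_rhs_eq)

lemma remove_sings_stern_lhs_analytic:
  "remove_sings (\<lambda>z. stern_lhs stern_V z $ i) analytic_on stern_domain"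
  using stern_rhs_analytic[of i] unfolding analytic_on_open[OF open_stern_domain]
  by (rule holomorphic_transform) (simp add: remove_sings_stern_lhs)

theorem theorem5p1:
  shows "(\<exists>\<Phi> :: real \<Rightarrow> real.
            (\<forall>x. \<Phi> (x + 1) = \<Phi> x) \<and>
            continuous_on UNIV \<Phi> \<and>
            (\<forall>\<alpha>. 0 < \<alpha> \<and> \<alpha> < log 2 3 - log 2 golden_ratio \<longrightarrow> holder_continuous \<alpha> \<Phi>) \<and>
            (\<lambda>N :: nat. real_of_int (stern_sum N)
                         - real N powr (log 2 3) * \<Phi> (frac (log 2 (real N))))
              \<in> O(\<lambda>N. real N powr (log 2 golden_ratio)))
       \<and>
       (\<exists>V :: complex \<Rightarrow> complex ^ 2.
          (let H = {s :: complex. Re s > log 2 golden_ratio} in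
            (\<forall>s. Re s > log 2 3 \<longrightarrow>
               ((\<lambda>n :: nat. (of_nat n powr (- s)) *s stern_vec n) has_sum V s) {1..}) \<and>
            (\<forall>i. (\<lambda>s. V s $ i) nicely_meromorphic_on H) \<and>
            (\<forall>s\<in>H. stern_rhs_term V s summable_on {1..}) \<and>
            (\<forall>s\<in>H. (\<forall>i. \<not> is_pole (\<lambda>z. V z $ i) s) \<longrightarrow> stern_lhs V s = stern_rhs V s) \<and>
            (\<forall>i. \<forall>s\<in>H. remove_sings (\<lambda>z. stern_lhs V z $ i) s = stern_rhs V s $ i) \<and>
            (\<forall>i. remove_sings (\<lambda>z. stern_lhs V z $ i) analytic_on H) \<and>
            (\<forall>i. (\<lambda>s. stern_rhs V s $ i) analytic_on H) \<and>
            (\<forall>i. \<forall>s\<in>H. is_pole (\<lambda>z. V z $ i) s \<longrightarrow>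
               zorder (\<lambda>z. V z $ i) s = - 1 \<and>
               (\<exists>\<mu> :: int. s = of_real (log 2 3)
                            + 2 * of_real pi * \<i> * of_int \<mu> / of_real (ln 2)))))"
proof (rule conjI, goal_cases)
  case 1
  show ?case
    using stern_periodic_plus_1 stern_sum_asymptotics stern_periodic_holder stern_exponent_pos
      holder_continuous_imp_continuous_on[OF stern_periodic_holder[OF stern_exponent_pos order.refl]]
    by (intro exI[of _ stern_periodic]) (simp add: stern_exponent_def)
next
  case 2
  show ?case
    unfolding Let_def stern_domain_def[symmetric]
    using stern_V_has_sum stern_V_nicely_meromorphic has_sum_imp_summable[OF stern_rhs_term_has_sum]
      stern_lhs_eq_rhs remove_sings_stern_lhs remove_sings_stern_lhs_analytic stern_rhs_analytic
      stern_V_pole stern_denominator_zeroE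
    by (intro exI[of _ stern_V] conjI allI impI ballI) blast+
qed

end
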